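(* Let $\mathcal{X}=[a,b]$ (for real $a<b$) or $\mathcal{X}=\mathbb{R}$, let $n\ge1$, $\beta>1$, $\varepsilon_1,\varepsilon_2>0$. Consider the following algorithm on input $\mathbf{x}\in\mathcal{X}^n$: (1) For every integer $\ell\ge0$ set $\bar L^\ell(\mathbf{x})=L^\ell_{\mathrm{Var}}(\mathbf{x})$ if $\ell\le 100$ and $\bar L^\ell(\mathbf{x})=0$ if $\ell>100$. (2) If $\mathcal{X}=[a,b]$, set $\bar U^\ell(\mathbf{x})=\mathrm{Var}(\mathbf{x})+\ell(b-a)^2/n$ for all $\ell\ge0$; if $\mathcal{X}=\mathbb{R}$, set $\bar U^0(\mathbf{x})=\mathrm{Var}(\mathbf{x})$ and $\bar U^\ell(\mathbf{x})=+\infty$ for $\ell\ge1$. (3) Run $\texttt{AboveThreshold}$ on $\mathbf{x}$ with the query stream $q_i(\cdot)=\bar\rho(\cdot\,;\beta^i-1)$, $i=1,2,\dots$, with $\Delta=1$, $T=0$ and parameters $\varepsilon_1,\varepsilon_2$; if the output is $\bot^{k-1}\top$, return $\beta^k-1$. Then this algorithm is $(\varepsilon_1+2\varepsilon_2)$-differentially private and has running time $O(n+q)$, where $q$ is the number of queries made in $\texttt{AboveThreshold}$.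
   Context: For a vector $\mathbf{z}=(z_1,\dots,z_m)\in\mathbb{R}^m$, $\mathrm{Var}(\mathbf{z})=\frac1m\sum_{i=1}^m(z_i-\bar z)^2$ with $\bar z=\frac1m\sum_i z_i$. For $\mathbf{x},\mathbf{x}'\in\mathcal{X}^n$, $d_{\mathrm{ham}}(\mathbf{x},\mathbf{x}')=|\{i:\mathbf{x}_i\neq\mathbf{x}'_i\}|$; neighboring means $d_{\mathrm{ham}}\le1$. $L^\ell_{\mathrm{Var}}(\mathbf{x})=\inf\{\mathrm{Var}(\mathbf{x}'):\mathbf{x}'\in\mathbb{R}^n,\ d_{\mathrm{ham}}(\mathbf{x},\mathbf{x}')\le\ell\}$. $\overline{\mathrm{len}}(\mathbf{x};t)=\inf\{\ell\in\mathbb{Z}_{\ge0}:\bar L^\ell(\mathbf{x})\le t\le\bar U^\ell(\mathbf{x})\}$ ($\inf\emptyset=+\infty$) and $\bar\rho(\mathbf{x};t)=\mathrm{sgn}(t-\mathrm{Var}(\mathbf{x}))(\overline{\mathrm{len}}(\mathbf{x};t)-\tfrac12)$ with $\mathrm{sgn}(0)=0$. A randomized mechanism $M$ on $\mathcal{X}^n$ is $\varepsilon$-differentially private if for all neighboring $\mathbf{x},\mathbf{x}'$ and measurable $S$, $\Pr[M(\mathbf{x})\in S]\le e^\varepsilon\Pr[M(\mathbf{x}')\in S]$. $\texttt{AboveThreshold}$ (input $\mathbf{x}$, queries $q_1,q_2,\dots$, sensitivity $\Delta$, threshold $T$, parameters $\varepsilon_1,\varepsilon_2$): set $\hat T=T+Z$,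 $Z$ exponential with scale $\Delta/\varepsilon_1$; for $i=1,2,\dots$ draw independent $\nu_i$ exponential with scale $\Delta/\varepsilon_2$; if $q_i(\mathbf{x})+\nu_i\ge\hat T$ output $\top$ and halt, else output $\bot$. *)

theory Defs
  imports "HOL-Probability.Probability"
begin

section \<open>Variance, Hamming distance and the bounds on the variance\<close>

datatype domain = Interval real real | RealLine

fun dom_set :: "domain \<Rightarrow> real set" where
  "dom_set (Interval a b) = {a..b}"
| "dom_set RealLine = UNIV"

fun valid_domain :: "domain \<Rightarrow> bool" where
  "valid_domain (Interval a b) \<longleftrightarrow> a < b"
| "valid_domain RealLine \<longleftrightarrow> True"

definition datasets :: "domain \<Rightarrow> nat \<Rightarrow> real list set" where
  "datasets D n = {x. length x = n \<and> set x \<subseteq> dom_set D}"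

definition vec_mean :: "real list \<Rightarrow> real" where
  "vec_mean z = (\<Sum>i<length z. z ! i) / real (length z)"

definition vec_var :: "real list \<Rightarrow> real" where
  "vec_var z = (\<Sum>i<length z. (z ! i - vec_mean z)\<^sup>2) / real (length z)"

text \<open>Only applied to lists of equal length.\<close>

definition d_ham :: "real list \<Rightarrow> real list \<Rightarrow> nat" where
  "d_ham x x' = card {i. i < length x \<and> x ! i \<noteq> x' ! i}"

text \<open>The competitors \<open>x'\<close> range over all real vectors, also when the data domain is an interval.\<close>

definition L_var :: "nat \<Rightarrow> real list \<Rightarrow> real" where
  "L_var l x = Inf {vec_var x' | x'. length x' = length x \<and> d_ham x x' \<le> l}"

definition L_bar :: "nat \<Rightarrow> real list \<Rightarrow> real" where
  "L_bar l x = (if l \<le> 100 then L_var l x else 0)"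

fun U_bar :: "domain \<Rightarrow> nat \<Rightarrow> real list \<Rightarrow> ereal" where
  "U_bar (Interval a b) l x = ereal (vec_var x + real l * (b - a)\<^sup>2 / real (length x))"
| "U_bar RealLine l x = (if l = 0 then ereal (vec_var x) else \<infinity>)"

text \<open>In \<^typ>\<open>enat\<close> the infimum of the empty set is \<open>\<infinity>\<close>.\<close>

definition len_bar :: "domain \<Rightarrow> real list \<Rightarrow> real \<Rightarrow> enat" where
  "len_bar D x t = Inf {enat l | l. ereal (L_bar l x) \<le> ereal t \<and> ereal t \<le> U_bar D l x}"

text \<open>In \<^typ>\<open>ereal\<close> we have \<open>0 * \<infinity> = 0\<close>, so the value is \<open>0\<close> whenever \<open>t\<close> is the variance of \<open>x\<close>.\<close>

definition rho_bar :: "domain \<Rightarrow> real list \<Rightarrow> real \<Rightarrow> ereal" where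
  "rho_bar D x t =
     ereal (sgn (t - vec_var x)) * (ereal_of_enat (len_bar D x t) - ereal (1 / 2))"

section \<open>Differential privacy\<close>

text \<open>A mechanism maps each dataset in \<open>X\<close> to a probability measure on the output space \<open>Y\<close>.\<close>

definition differentially_private ::
    "real list set \<Rightarrow> 'y measure \<Rightarrow> real \<Rightarrow> (real list \<Rightarrow> 'y measure) \<Rightarrow> bool" where
  "differentially_private X Y eps M \<longleftrightarrow>
     (\<forall>x\<in>X. M x \<in> space (prob_algebra Y)) \<and>
     (\<forall>x\<in>X. \<forall>x'\<in>X. d_ham x x' \<le> 1 \<longrightarrow>
        (\<forall>S\<in>sets Y. measure (M x) S \<le> exp eps * measure (M x') S))"

section \<open>AboveThreshold\<close>

definition exponential :: "real \<Rightarrow> real measure" where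
  "exponential s = density lborel (exponential_density (1 / s))"

lemma distr_scale_exponential:
  assumes "s > 0"
  shows "distr (exponential 1) borel (\<lambda>u. s * u) = exponential s"
proof -
  have [measurable]: "exponential_density l \<in> borel_measurable borel" for l
    unfolding exponential_density_def by measurable
  interpret prob_space "exponential 1"
    unfolding exponential_def using prob_space_exponential_density[of 1] by simp
  have "distr (exponential 1) lborel (\<lambda>u. u) = exponential 1"
    by (rule distr_id2) (simp add: exponential_def)
  then have "distributed (exponential 1) lborel (\<lambda>u. u) (exponential_density 1)"
    unfolding distributed_def by (simp add: exponential_def)
  from distributed_affine[OF this, of s 0] assms
  have "distributed (exponential 1) lborel (\<lambda>u. u * s)
          (\<lambda>x. ennreal (exponential_density 1 (x / s)) / ennreal s)"
    by (simp add: mult.commute)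
  then have "distr (exponential 1) lborel (\<lambda>u. u * s) =
      density lborel (\<lambda>x. ennreal (exponential_density 1 (x / s)) / ennreal s)"
    unfolding distributed_def by simp
  also have "\<dots> = exponential s"
    unfolding exponential_def using assms
    by (intro density_cong)
       (auto simp: exponential_density_def divide_less_0_iff divide_ennreal)
  also have "distr (exponential 1) lborel (\<lambda>u. u * s) = distr (exponential 1) borel (\<lambda>u. s * u)"
    by (rule distr_cong) (simp_all add: mult.commute)
  finally show ?thesis .
qed

text \<open>The noise is the pair of the threshold noise \<open>Z\<close> and the stream \<open>\<nu>\<^sub>1, \<nu>\<^sub>2, \<dots>\<close>.\<close>

definition above_threshold_noise :: "real \<Rightarrow> real \<Rightarrow> real \<Rightarrow> (real \<times> (nat \<Rightarrow> real)) measure" where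
  "above_threshold_noise \<Delta> eps1 eps2 =
     exponential (\<Delta> / eps1) \<Otimes>\<^sub>M (\<Pi>\<^sub>M i\<in>{1..}. exponential (\<Delta> / eps2))"

text \<open>
  \<open>Some k\<close> encodes the output \<open>\<bottom>\<close> (\<open>k - 1\<close> times) followed by \<open>\<top>\<close>, so that \<open>k\<close> is the number
  of queries made; \<open>None\<close> encodes the infinite output \<open>\<bottom>, \<bottom>, \<dots>\<close>.
\<close>

definition above_threshold ::
    "real list \<Rightarrow> (nat \<Rightarrow> real list \<Rightarrow> ereal) \<Rightarrow> real \<Rightarrow> real \<times> (nat \<Rightarrow> real) \<Rightarrow> nat option" where
  "above_threshold x q T = (\<lambda>(Z, \<nu>).
     let above = (\<lambda>i. q i x + ereal (\<nu> i) \<ge> ereal (T + Z))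
     in if \<exists>i\<ge>1. above i then Some (LEAST i. i \<ge> 1 \<and> above i) else None)"

section \<open>The mechanism\<close>

text \<open>The number of queries made on input \<open>x\<close> with the given noise.\<close>

definition num_queries ::
    "domain \<Rightarrow> real \<Rightarrow> real list \<Rightarrow> real \<times> (nat \<Rightarrow> real) \<Rightarrow> nat option" where
  "num_queries D \<beta> x noise = above_threshold x (\<lambda>i y. rho_bar D y (\<beta> ^ i - 1)) 0 noise"

definition var_output ::
    "domain \<Rightarrow> real \<Rightarrow> real list \<Rightarrow> real \<times> (nat \<Rightarrow> real) \<Rightarrow> real option" where
  "var_output D \<beta> x noise = map_option (\<lambda>k. \<beta> ^ k - 1) (num_queries D \<beta> x noise)"

text \<open>The Borel space on the reals with an additional isolated point for non-termination.\<close>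

definition output_space :: "real option measure" where
  "output_space = sigma UNIV {S. Some -` S \<in> sets borel}"

definition var_mechanism ::
    "domain \<Rightarrow> real \<Rightarrow> real \<Rightarrow> real \<Rightarrow> real list \<Rightarrow> real option measure" where
  "var_mechanism D \<beta> eps1 eps2 x =
     distr (above_threshold_noise 1 eps1 eps2) output_space (var_output D \<beta> x)"

section \<open>A unit-cost real RAM\<close>

text \<open>
  Running times refer to a real RAM: programs have natural-number registers (used as counters
  and addresses), real registers and a real-valued memory addressed by natural numbers. Real
  arithmetic, comparison and rounding down are exact and cost one step, and so does drawing an
  exponential variate of a given scale. A program is a finite object with integer constants only.
  Every assignment and every test of a condition costs one step; as the expressions
  in a fixed program have bounded size, charging by the size of the expression instead
  would change running times by at most a constant factor.
\<close>

datatype nexp = NConst nat | NVar string | NAdd nexp nexp | NSub nexp nexp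

datatype rexp = RConst int | RVar string | RLoad nexp | ROfNat nexp
  | RAdd rexp rexp | RSub rexp rexp | RMul rexp rexp | RDiv rexp rexp | RFloor rexp

datatype bexp = NLess nexp nexp | RLess rexp rexp | BNot bexp | BAnd bexp bexp

datatype com = Skip
  | NAssign string nexp
  | RAssign string rexp
  | RStore nexp rexp
  | Draw string rexp
  | Seq com com
  | Cond bexp com com
  | While bexp com

record state =
  nreg :: "string \<Rightarrow> nat"
  rreg :: "string \<Rightarrow> real"
  mem :: "nat \<Rightarrow> real"
  draws :: nat  \<comment> \<open>how many random variates have been consumed\<close>

fun nval :: "nexp \<Rightarrow> state \<Rightarrow> nat" where
  "nval (NConst k) s = k"
| "nval (NVar v) s = nreg s v"
| "nval (NAdd e f) s = nval e s + nval f s"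
| "nval (NSub e f) s = nval e s - nval f s"

fun rval :: "rexp \<Rightarrow> state \<Rightarrow> real" where
  "rval (RConst c) s = of_int c"
| "rval (RVar v) s = rreg s v"
| "rval (RLoad e) s = mem s (nval e s)"
| "rval (ROfNat e) s = real (nval e s)"
| "rval (RAdd e f) s = rval e s + rval f s"
| "rval (RSub e f) s = rval e s - rval f s"
| "rval (RMul e f) s = rval e s * rval f s"
| "rval (RDiv e f) s = rval e s / rval f s"
| "rval (RFloor e) s = of_int \<lfloor>rval e s\<rfloor>"

fun bval :: "bexp \<Rightarrow> state \<Rightarrow> bool" where
  "bval (NLess e f) s \<longleftrightarrow> nval e s < nval f s"
| "bval (RLess e f) s \<longleftrightarrow> rval e s < rval f s"
| "bval (BNot b) s \<longleftrightarrow> \<not> bval b s"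
| "bval (BAnd b c) s \<longleftrightarrow> bval b s \<and> bval c s"

text \<open>
  \<open>exec u c s m s'\<close>: started in \<open>s\<close>, the command \<open>c\<close> terminates in \<open>s'\<close> after exactly \<open>m\<close> steps.
  The source of randomness is a stream \<open>u\<close> of independent standard exponential variates; by
  \<open>distr_scale_exponential\<close>, a variate of scale \<open>c > 0\<close> is \<open>c\<close> times the next element of \<open>u\<close>.
\<close>

inductive exec :: "(nat \<Rightarrow> real) \<Rightarrow> com \<Rightarrow> state \<Rightarrow> nat \<Rightarrow> state \<Rightarrow> bool" for u where
  Skip: "exec u Skip s 1 s"
| NAssign: "exec u (NAssign v e) s 1 (s\<lparr>nreg := (nreg s)(v := nval e s)\<rparr>)"
| RAssign: "exec u (RAssign v e) s 1 (s\<lparr>rreg := (rreg s)(v := rval e s)\<rparr>)"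
| RStore: "exec u (RStore e f) s 1 (s\<lparr>mem := (mem s)(nval e s := rval f s)\<rparr>)"
| Draw: "exec u (Draw v e) s 1
    (s\<lparr>rreg := (rreg s)(v := rval e s * u (draws s)), draws := Suc (draws s)\<rparr>)"
| Seq: "exec u c1 s m1 s1 \<Longrightarrow> exec u c2 s1 m2 s2 \<Longrightarrow> exec u (Seq c1 c2) s (m1 + m2) s2"
| CondTrue: "bval b s \<Longrightarrow> exec u c1 s m s' \<Longrightarrow> exec u (Cond b c1 c2) s (Suc m) s'"
| CondFalse: "\<not> bval b s \<Longrightarrow> exec u c2 s m s' \<Longrightarrow> exec u (Cond b c1 c2) s (Suc m) s'"
| WhileFalse: "\<not> bval b s \<Longrightarrow> exec u (While b c) s 1 s"
| WhileTrue: "bval b s \<Longrightarrow> exec u c s m1 s1 \<Longrightarrow> exec u (While b c) s1 m2 s2 \<Longrightarrow>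
    exec u (While b c) s (Suc (m1 + m2)) s2"

text \<open>
  The input consists of the parameters, the data \<open>x\<close> in memory cells \<open>0, \<dots>, n - 1\<close> and its length
  \<open>n\<close>; the register \<open>bounded\<close> tells whether the domain is an interval. All other registers and
  cells are zero.
\<close>

fun domain_regs :: "domain \<Rightarrow> (string \<Rightarrow> real) \<Rightarrow> (string \<Rightarrow> real)" where
  "domain_regs (Interval a b) r = r(''bounded'' := 1, ''a'' := a, ''b'' := b)"
| "domain_regs RealLine r = r"

definition initial_state :: "domain \<Rightarrow> real \<Rightarrow> real \<Rightarrow> real \<Rightarrow> real list \<Rightarrow> state" where
  "initial_state D \<beta> eps1 eps2 x =
     \<lparr>nreg = (\<lambda>_. 0)(''n'' := length x),
      rreg = domain_regs D ((\<lambda>_. 0)(''beta'' := \<beta>, ''eps1'' := eps1, ''eps2'' := eps2)),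
      mem = (\<lambda>i. if i < length x then x ! i else 0),
      draws = 0\<rparr>"

text \<open>On the given input and randomness \<open>p\<close> halts after \<open>m\<close> steps and returns \<open>y\<close>.\<close>

definition returns :: "com \<Rightarrow> domain \<Rightarrow> real \<Rightarrow> real \<Rightarrow> real \<Rightarrow> real list \<Rightarrow> (nat \<Rightarrow> real) \<Rightarrow>
    nat \<Rightarrow> real \<Rightarrow> bool" where
  "returns p D \<beta> eps1 eps2 x u m y \<longleftrightarrow>
     (\<exists>s. exec u p (initial_state D \<beta> eps1 eps2 x) m s \<and> rreg s ''out'' = y)"

text \<open>
  The noise of AboveThreshold (with sensitivity \<open>1\<close>) obtained from the stream \<open>u\<close>: the
  first variate is used for \<open>Z\<close>, the following ones for \<open>\<nu>\<^sub>1, \<nu>\<^sub>2, \<dots>\<close> in this order.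
\<close>

definition noise_of :: "real \<Rightarrow> real \<Rightarrow> (nat \<Rightarrow> real) \<Rightarrow> real \<times> (nat \<Rightarrow> real)" where
  "noise_of eps1 eps2 u = (1 / eps1 * u 0, \<lambda>i\<in>{1..}. 1 / eps2 * u i)"

end

theory Submission
  imports Defs
begin

text \<open>
  Privacy. The bounds shift by one level between neighbours: the lower bound of level \<open>l + 1\<close> at
  \<open>x'\<close> is at most the one of level \<open>l\<close> at \<open>x\<close>, and dually for the upper bounds. Hence the
  lengths of neighbours differ by at most 1, and both are at most 1 if the signs differ, so that
  \<open>rho_bar\<close> has sensitivity 1. Translating an exponential variate costs an exponential factor in
  the density; shifting the threshold noise by 1 and the noise of the accepted query by 2 maps the
  event of a given output on \<open>x\<close> into the same event on \<open>x'\<close>.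

  Running time. An optimal change of \<open>l\<close> entries deletes some \<open>i\<close> smallest and \<open>l - i\<close> largest
  values and fills up with the mean of the rest. For the boundedly many pairs with \<open>l \<le> 100\<close> the
  sum of squared deviations of the remaining values takes linear time; afterwards every query takes
  constant time, since the length is either found among these bounds or given by a rounded quotient.
\<close>

section \<open>Lower bounds on the variance by trimming\<close>

text \<open>Sorting by comparisons would cost order n log n, so extremes are found by repeated
  linear passes that permute the data in place. This is affordable because only levels up to 100 are
  computed, and it is why the variance is treated as a function of a multiset. The exchange argument
  works with deviations from a fixed centre c, since the mean itself moves when elements are
  exchanged. The delicate case of the sensitivity bound is a value t between the two variances.
  There the offset 1/2 keeps both queries within [-1/2, 1/2], although their signs differ.
  Exponential noise is one-sided: its density is controlled under raising the variate only, which is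
  why both noises are raised and never lowered. There are only countably many outcomes of the
  threshold test, so it suffices to compare probabilities of single outcomes.\<close>

definition sq_dev :: "real multiset \<Rightarrow> real \<Rightarrow> real" where
  "sq_dev A c = (\<Sum>y\<in>#A. (y - c)\<^sup>2)"

text \<open>The sum of squared deviations from the mean, in the form that needs only two running
  sums and hence a single pass of the program. On the empty multiset the division by zero yields 0,
  the correct value once all entries may be changed.\<close>

definition ssd :: "real multiset \<Rightarrow> real" where
  "ssd A = (\<Sum>y\<in>#A. y\<^sup>2) - (\<Sum>y\<in>#A. y)\<^sup>2 / real (size A)"

lemma sq_dev_expand:
  "sq_dev A c = (\<Sum>y\<in>#A. y\<^sup>2) - 2 * c * (\<Sum>y\<in>#A. y) + real (size A) * c\<^sup>2"
  by (induction A) (simp_all add: sq_dev_def power2_eq_square algebra_simps)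

lemma sq_dev_nonneg: "0 \<le> sq_dev A c"
  unfolding sq_dev_def by (induction A) auto

lemma sq_dev_union: "sq_dev (A + B) c = sq_dev A c + sq_dev B c"
  by (simp add: sq_dev_def)

lemma sq_dev_add_mset: "sq_dev (add_mset y A) c = (y - c)\<^sup>2 + sq_dev A c"
  by (simp add: sq_dev_def)

lemma sq_dev_mono: "A \<subseteq># B \<Longrightarrow> sq_dev A c \<le> sq_dev B c"
  by (metis sq_dev_nonneg sq_dev_union le_add_same_cancel1 subset_mset.add_diff_inverse)

text \<open>The parallel axis identity: the excess over \<open>ssd\<close> is a square that vanishes
  at the mean, so the mean is the best centre.\<close>

lemma sq_dev_eq_ssd:
  assumes "A \<noteq> {#}"
  shows "sq_dev A c = ssd A + real (size A) * (c - (\<Sum>y\<in>#A. y) / real (size A))\<^sup>2"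
proof -
  have "real (size A) \<noteq> 0" using assms by simp
  then show ?thesis
    unfolding sq_dev_expand ssd_def by (simp add: field_simps power2_eq_square)
qed

lemma ssd_le_sq_dev: "ssd A \<le> sq_dev A c"
proof (cases "A = {#}")
  case True then show ?thesis by (simp add: ssd_def sq_dev_def)
next
  case False then show ?thesis by (simp add: sq_dev_eq_ssd)
qed

lemma ssd_eq_sq_dev_mean: "ssd A = sq_dev A ((\<Sum>y\<in>#A. y) / real (size A))"
proof (cases "A = {#}")
  case True then show ?thesis by (simp add: ssd_def sq_dev_def)
next
  case False then show ?thesis by (simp add: sq_dev_eq_ssd)
qed

lemma sum_mset_mset_nth: "(\<Sum>y\<in>#mset z. f y) = (\<Sum>i<length z. f (z ! i))"
  using sum_list_sum_nth[of "map f z"]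
  by (simp add: lessThan_atLeast0 sum_mset_sum_list flip: mset_map)

lemma vec_var_ssd: "vec_var z = ssd (mset z) / real (length z)"
  unfolding ssd_eq_sq_dev_mean sq_dev_def vec_var_def vec_mean_def sum_mset_mset_nth by simp

section \<open>Hamming distance in terms of common submultisets\<close>

lemma d_ham_Cons:
  "d_ham (y # ys) (z # zs) = (if y = z then 0 else 1) + d_ham ys zs"
proof -
  have "{i. i < length (y # ys) \<and> (y # ys) ! i \<noteq> (z # zs) ! i} =
     (if y = z then {} else {0}) \<union> Suc ` {i. i < length ys \<and> ys ! i \<noteq> zs ! i}"
    by (auto simp: image_iff less_Suc_eq_0_disj)
  then show ?thesis unfolding d_ham_def by (auto simp: card_image)
qed

text \<open>The positions where the two vectors agree supply \<open>A\<close>.\<close>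

lemma d_ham_common:
  assumes "length x = length x'"
  shows "\<exists>A. A \<subseteq># mset x \<and> A \<subseteq># mset x' \<and> length x \<le> size A + d_ham x x'"
  using assms
proof (induction x x' rule: list_induct2)
  case Nil then show ?case by simp
next
  case (Cons y ys z zs)
  then obtain A where A: "A \<subseteq># mset ys" "A \<subseteq># mset zs" "length ys \<le> size A + d_ham ys zs"
    by auto
  show ?case
  proof (cases "y = z")
    case True
    with A show ?thesis by (intro exI[of _ "add_mset y A"]) (auto simp: d_ham_Cons)
  next
    case False
    with A show ?thesis
      by (intro exI[of _ A]) (auto simp: d_ham_Cons intro: subset_mset.trans)
  qed
qed

text \<open>Converse of \<open>d_ham_common\<close>: keep positions that make up \<open>A\<close>
  and overwrite the others by \<open>c\<close>. The distance is only bounded, because an overwritten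
  entry may have been equal to \<open>c\<close> already.\<close>

lemma d_ham_fill:
  assumes "A \<subseteq># mset x"
  shows "\<exists>x'. length x' = length x \<and> d_ham x x' + size A \<le> length x \<and>
     mset x' = A + replicate_mset (length x - size A) c"
  using assms
proof (induction x arbitrary: A)
  case Nil then show ?case by (simp add: d_ham_def)
next
  case (Cons y ys)
  show ?case
  proof (cases "y \<in># A")
    case True
    then obtain B where B: "A = add_mset y B" by (metis insert_DiffM)
    with Cons.prems have "B \<subseteq># mset ys" by simp
    from Cons.IH[OF this] obtain zs where "length zs = length ys"
      "d_ham ys zs + size B \<le> length ys" "mset zs = B + replicate_mset (length ys - size B) c"
      by auto
    then show ?thesis using B by (intro exI[of _ "y # zs"]) (auto simp: d_ham_Cons)
  next
    case False
    have sub: "A \<subseteq># mset ys"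
    proof (rule mset_subset_eqI)
      show "count A a \<le> count (mset ys) a" for a
        using mset_subset_eq_count[OF Cons.prems, of a] False
        by (cases "a = y") (auto simp: not_in_iff)
    qed
    from Cons.IH[OF this] obtain zs where "length zs = length ys"
      "d_ham ys zs + size A \<le> length ys" "mset zs = A + replicate_mset (length ys - size A) c"
      by auto
    moreover have "size A \<le> length ys" using size_mset_mono[OF sub] by simp
    ultimately show ?thesis
      by (intro exI[of _ "c # zs"]) (auto simp: d_ham_Cons Suc_diff_le)
  qed
qed

section \<open>Deleting extreme elements of a multiset\<close>

definition remove_min :: "real multiset \<Rightarrow> real multiset" where
  "remove_min M = M - {#Min_mset M#}"

definition remove_max :: "real multiset \<Rightarrow> real multiset" where
  "remove_max M = M - {#Max_mset M#}"

lemma remove_min_eq: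
  "r \<in># M \<Longrightarrow> (\<And>y. y \<in># M \<Longrightarrow> r \<le> y) \<Longrightarrow> remove_min M = M - {#r#}"
  unfolding remove_min_def by (subst Min_eqI[of _ r]) auto

lemma remove_max_eq:
  "r \<in># M \<Longrightarrow> (\<And>y. y \<in># M \<Longrightarrow> y \<le> r) \<Longrightarrow> remove_max M = M - {#r#}"
  unfolding remove_max_def by (subst Max_eqI[of _ r]) auto

lemma remove_min_empty [simp]: "remove_min {#} = {#}"
  and remove_max_empty [simp]: "remove_max {#} = {#}"
  by (simp_all add: remove_min_def remove_max_def)

text \<open>If the maximum survives the deletion of the minimum, the two deletions take different
  occurrences. Otherwise \<open>M\<close> is a singleton and both sides are empty.\<close>

lemma remove_min_max_commute: "remove_min (remove_max M) = remove_max (remove_min M)"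
proof (cases "M = {#}")
  case False
  define p r where "p = Min_mset M" and "r = Max_mset M"
  have p: "p \<in># M" "\<And>y. y \<in># M \<Longrightarrow> p \<le> y" and r: "r \<in># M" "\<And>y. y \<in># M \<Longrightarrow> y \<le> r"
    using False by (auto simp: p_def r_def)
  show ?thesis
  proof (cases "r \<in># M - {#p#}")
    case True
    then have "p \<in># M - {#r#}" using p(1) r(1)
      by (metis diff_single_trivial diff_union_swap insert_DiffM insert_noteq_member
          multi_member_split union_single_eq_member add_mset_remove_trivial)
    then have "remove_min (M - {#r#}) = M - {#r#} - {#p#}"
      using p(2) by (intro remove_min_eq) (auto dest: in_diffD)
    moreover have "remove_max (M - {#p#}) = M - {#p#} - {#r#}"
      using True r(2) by (intro remove_max_eq) (auto dest: in_diffD)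
    ultimately show ?thesis
      using remove_min_eq[OF p] remove_max_eq[OF r] by (simp add: add_mset_commute)
  next
    case no_r: False
    have "r = p" by (rule ccontr) (use no_r r(1) in \<open>simp add: in_diff_count\<close>)
    then have "M - {#p#} = {#}" using no_r p r
      by (metis Diff_eq_empty_iff_mset antisym diff_subset_eq_self in_diffD multiset_nonemptyE mset_subset_eqD)
    then show ?thesis using \<open>r = p\<close> remove_min_eq[OF p] remove_max_eq[OF r] by simp
  qed
qed simp

text \<open>One deletion at a time suits the induction of the exchange argument; the form that the
  program evaluates is \<open>min_ssd_eq_Min\<close>.\<close>

fun min_ssd :: "real multiset \<Rightarrow> nat \<Rightarrow> real" where
  "min_ssd M 0 = ssd M"
| "min_ssd M (Suc l) = min (min_ssd (remove_min M) l) (min_ssd (remove_max M) l)"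

lemma min_ssd_empty [simp]: "min_ssd {#} l = 0"
  by (induction l) (simp_all add: ssd_def)

lemma min_ssd_attained:
  "\<exists>A. A \<subseteq># M \<and> size M \<le> size A + l \<and> min_ssd M l = ssd A"
proof (induction l arbitrary: M)
  case 0 then show ?case by auto
next
  case (Suc l)
  have 1: "remove_min M \<subseteq># M" "remove_max M \<subseteq># M"
    by (simp_all add: remove_min_def remove_max_def)
  have 2: "size M \<le> Suc (size (remove_min M))" "size M \<le> Suc (size (remove_max M))"
    by (cases "M = {#}"; simp add: remove_min_def remove_max_def size_Diff_singleton)+
  obtain N where N: "N = remove_min M \<or> N = remove_max M" "min_ssd M (Suc l) = min_ssd N l"
    using that by (cases "min_ssd (remove_min M) l \<le> min_ssd (remove_max M) l") (auto simp: min_def)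
  moreover obtain A where "A \<subseteq># N" "size N \<le> size A + l" "min_ssd N l = ssd A"
    using Suc.IH by blast
  ultimately show ?case using 1 2
    by (intro exI[of _ A]) (auto intro: subset_mset.trans)
qed

text \<open>
  Exchange argument: a submultiset that keeps both extremes of \<open>M\<close> but misses some \<open>s\<close> does not
  get worse when the extreme farther from \<open>c\<close> is replaced by \<open>s\<close>.
\<close>

lemma min_ssd_le_sq_dev:
  "A \<subseteq># M \<Longrightarrow> size M \<le> size A + l \<Longrightarrow> min_ssd M l \<le> sq_dev A c"
proof (induction l arbitrary: M A)
  case 0
  then have "A = M"
    by (metis add.right_neutral mset_subset_size not_less subset_mset.le_imp_less_or_eq)
  then show ?case by (simp add: ssd_le_sq_dev)
next
  case (Suc l)
  show ?case
  proof (cases "M = {#}")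
    case True
    then show ?thesis using Suc.prems by (simp add: sq_dev_nonneg)
  next
    case False
    define p r where "p = Min_mset M" and "r = Max_mset M"
    have p: "p \<in># M" "\<And>y. y \<in># M \<Longrightarrow> p \<le> y" and r: "r \<in># M" "\<And>y. y \<in># M \<Longrightarrow> y \<le> r"
      using False by (auto simp: p_def r_def)
    have rm: "remove_min M = M - {#p#}" "remove_max M = M - {#r#}"
      by (simp_all add: remove_min_def remove_max_def p_def r_def)
    \<comment> \<open>Deleting \<open>e\<close> uses up one of the \<open>Suc l\<close> permitted
      deletions. The replacement \<open>B\<close> for \<open>A\<close> may be one element smaller
      only if \<open>A\<close> has the full size of \<open>M\<close>.\<close>
    have step: "min_ssd M (Suc l) \<le> sq_dev A c"
      if e: "e = p \<or> e = r" and B: "B \<subseteq># M - {#e#}" "size A \<le> Suc (size B)" "size A = Suc (size B) \<longrightarrow> size M = size A"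
        "sq_dev B c \<le> sq_dev A c" for e B
    proof -
      have "size (M - {#e#}) \<le> size B + l"
        using e p(1) r(1) B(2,3) Suc.prems(2) size_mset_mono[OF Suc.prems(1)]
        by (auto simp: size_Diff_singleton)
      from Suc.IH[OF B(1) this] have "min_ssd (M - {#e#}) l \<le> sq_dev A c" using B(4) by simp
      then show ?thesis using e by (auto simp: rm min_le_iff_disj)
    qed
    \<comment> \<open>\<open>A\<close> keeps every copy of \<open>e\<close>, so \<open>e\<close> can
      be deleted only after one copy is traded for the missing \<open>s\<close>; this preserves the
      size.\<close>
    have exch: "min_ssd M (Suc l) \<le> sq_dev A c"
      if e: "e = p \<or> e = r" and cnt: "count A e = count M e"
        and s: "count A s < count M s" "(s - c)\<^sup>2 \<le> (e - c)\<^sup>2" for e s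
    proof (rule step[OF e, of "add_mset s (A - {#e#})"])
      have "s \<noteq> e" using cnt s by auto
      have eA: "e \<in># A" using e p(1) r(1) cnt by (metis count_eq_zero_iff)
      show "add_mset s (A - {#e#}) \<subseteq># M - {#e#}"
        using \<open>s \<noteq> e\<close> s(1) mset_subset_eq_count[OF Suc.prems(1)] eA
        by (auto simp: subseteq_mset_def Suc_le_eq intro: diff_le_mono)
      show "size A \<le> Suc (size (add_mset s (A - {#e#})))"
        "size A = Suc (size (add_mset s (A - {#e#}))) \<longrightarrow> size M = size A"
        using eA by (simp_all add: size_Suc_Diff1)
      show "sq_dev (add_mset s (A - {#e#})) c \<le> sq_dev A c"
        using s(2) sq_dev_add_mset[of e "A - {#e#}" c] eA by (simp add: sq_dev_add_mset)
    qed
    have sub: "A \<subseteq># M - {#e#}" if "count A e \<noteq> count M e" for e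
    proof (rule mset_subset_eqI)
      show "count A a \<le> count (M - {#e#}) a" for a
        using mset_subset_eq_count[OF Suc.prems(1), of a] that by (cases "a = e") auto
    qed
    show ?thesis
    proof (cases "count A p = count M p \<and> count A r = count M r")
      case False
      then show ?thesis using step[of p A] step[of r A] sub by auto
    next
      case both: True
      show ?thesis
      proof (cases "A = M")
        case True
        show ?thesis
          by (rule step[of p "A - {#p#}"])
            (use p(1) in \<open>simp_all add: True size_Suc_Diff1 sq_dev_mono\<close>)
      next
        case False
        then obtain s where s: "count A s < count M s"
          using mset_subset_eq_count[OF Suc.prems(1)] by (meson le_neq_implies_less multiset_eqI)
        then have "s \<in># M" by (metis count_inI not_less0)
        then have "p \<le> s" "s \<le> r" by (simp_all add: p(2) r(2))
        \<comment> \<open>As \<open>s\<close> lies between \<open>p\<close> and \<open>r\<close>, at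
          least one of these ends is no closer to \<open>c\<close> than \<open>s\<close>.\<close>
        then have "\<bar>s - c\<bar> \<le> \<bar>p - c\<bar> \<or> \<bar>s - c\<bar> \<le> \<bar>r - c\<bar>" by linarith
        then have "(s - c)\<^sup>2 \<le> (p - c)\<^sup>2 \<or> (s - c)\<^sup>2 \<le> (r - c)\<^sup>2"
          by (simp only: abs_le_square_iff)
        then show ?thesis using both s exch by blast
      qed
    qed
  qed
qed

text \<open>A competitor shares with \<open>x\<close> a part \<open>A\<close> of all but at most
  \<open>l\<close> entries, and its deviations about its own mean dominate those of
  \<open>A\<close>. Conversely, filling the freed entries with the mean of an optimal
  \<open>A\<close> adds no deviation, so the infimum is a minimum.\<close>

lemma L_var_attained:
  assumes "x \<noteq> []"
  shows "L_var l x = min_ssd (mset x) l / real (length x)" (is ?eq)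
    and "\<exists>x'. length x' = length x \<and> d_ham x x' \<le> l \<and> vec_var x' = L_var l x"
    and "length z = length x \<Longrightarrow> d_ham x z \<le> l \<Longrightarrow> L_var l x \<le> vec_var z"
proof -
  let ?V = "{vec_var x' | x'. length x' = length x \<and> d_ham x x' \<le> l}"
  let ?m = "min_ssd (mset x) l"
  have n: "real (length x) > 0" using assms by simp
  have lower: "?m / real (length x) \<le> vec_var x'"
    if x': "length x' = length x" "d_ham x x' \<le> l" for x'
  proof -
    obtain A where A: "A \<subseteq># mset x" "A \<subseteq># mset x'" "length x \<le> size A + d_ham x x'"
      using d_ham_common[OF x'(1)[symmetric]] by blast
    define c where "c = (\<Sum>y\<in>#mset x'. y) / real (size (mset x'))"
    have "?m \<le> sq_dev A c" by (rule min_ssd_le_sq_dev) (use A x' in auto)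
    also have "\<dots> \<le> ssd (mset x')" using A(2) by (simp add: ssd_eq_sq_dev_mean c_def sq_dev_mono)
    finally show ?thesis using x' n by (simp add: vec_var_ssd divide_right_mono)
  qed
  obtain A where A: "A \<subseteq># mset x" "size (mset x) \<le> size A + l" "?m = ssd A"
    using min_ssd_attained by blast
  define c where "c = (\<Sum>y\<in>#A. y) / real (size A)"
  obtain x' where x': "length x' = length x" "d_ham x x' + size A \<le> length x"
    "mset x' = A + replicate_mset (length x - size A) c"
    using d_ham_fill[OF A(1)] by blast
  have "ssd (mset x') \<le> sq_dev (mset x') c" by (rule ssd_le_sq_dev)
  also have "\<dots> = sq_dev A c" by (simp add: x'(3) sq_dev_union) (simp add: sq_dev_def)
  also have "\<dots> = ?m" by (simp add: A(3) c_def ssd_eq_sq_dev_mean)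
  finally have "vec_var x' \<le> ?m / real (length x)"
    using n x'(1) by (simp add: vec_var_ssd divide_right_mono)
  moreover have near: "d_ham x x' \<le> l" using x'(2) A(2) by simp
  ultimately have att: "vec_var x' = ?m / real (length x)" using lower[OF x'(1) near] by simp
  show ?eq unfolding L_var_def
    by (rule cInf_eq_minimum) (use att[symmetric] x'(1) near lower in auto)
  then show "\<exists>x'. length x' = length x \<and> d_ham x x' \<le> l \<and> vec_var x' = L_var l x"
    using att x'(1) near by auto
  show "L_var l x \<le> vec_var z" if "length z = length x" "d_ham x z \<le> l"
    using lower[OF that] \<open>?eq\<close> by simp
qed

definition trim :: "nat \<Rightarrow> nat \<Rightarrow> real multiset \<Rightarrow> real multiset" where
  "trim i j M = (remove_max ^^ j) ((remove_min ^^ i) M)"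

lemma trim_remove_min: "trim i j (remove_min M) = trim (Suc i) j M"
  by (simp add: trim_def funpow_swap1)

lemma trim_remove_max: "trim i j (remove_max M) = trim i (Suc j) M"
proof -
  have "(remove_min ^^ i) (remove_max M) = remove_max ((remove_min ^^ i) M)"
    by (induction i) (simp_all add: remove_min_max_commute)
  then show ?thesis by (simp add: trim_def funpow_swap1)
qed

text \<open>Deletions at opposite ends commute, so of the 2^l sequences only the number j of
  deletions at the top matters. This leaves l + 1 candidates.\<close>

lemma min_ssd_eq_Min: "min_ssd M l = (MIN j\<in>{..l}. ssd (trim (l - j) j M))"
proof (induction l arbitrary: M)
  case 0 then show ?case by (simp add: trim_def)
next
  case (Suc l)
  let ?f = "\<lambda>j. ssd (trim (Suc l - j) j M)"
  have "min_ssd (remove_min M) l = Min (?f ` {..l})"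
    unfolding Suc.IH trim_remove_min by (intro arg_cong[of _ _ Min] image_cong) (auto simp: Suc_diff_le)
  moreover have "min_ssd (remove_max M) l = Min (?f ` Suc ` {..l})"
    unfolding Suc.IH trim_remove_max image_image by simp
  moreover have "?f ` {..Suc l} = ?f ` {..l} \<union> ?f ` Suc ` {..l}"
  proof -
    have "{..Suc l} = {..l} \<union> Suc ` {..l}" by (auto simp: image_iff le_Suc_eq)
    then show ?thesis by (simp only: image_Un)
  qed
  ultimately show ?case by (simp add: Min_Un)
qed

section \<open>Sensitivity of the queries\<close>

lemma d_ham_commute: "length x = length x' \<Longrightarrow> d_ham x x' = d_ham x' x"
  unfolding d_ham_def by (rule arg_cong[of _ _ card]) auto

lemma d_ham_triangle:
  assumes "length x = length y"
  shows "d_ham x z \<le> d_ham x y + d_ham y z"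
proof -
  have "{i. i < length x \<and> x ! i \<noteq> z ! i} \<subseteq>
      {i. i < length x \<and> x ! i \<noteq> y ! i} \<union> {i. i < length y \<and> y ! i \<noteq> z ! i}"
    using assms by auto
  then have "d_ham x z \<le> card ({i. i < length x \<and> x ! i \<noteq> y ! i} \<union> {i. i < length y \<and> y ! i \<noteq> z ! i})"
    unfolding d_ham_def by (intro card_mono) auto
  also have "\<dots> \<le> d_ham x y + d_ham y z" unfolding d_ham_def by (rule card_Un_le)
  finally show ?thesis .
qed

lemma vec_var_nonneg: "0 \<le> vec_var z"
  unfolding vec_var_def by (simp add: sum_nonneg)

lemma L_var_nonneg: "x \<noteq> [] \<Longrightarrow> 0 \<le> L_var l x"
  by (metis L_var_attained(2) vec_var_nonneg)

lemma L_var_le_vec_var: "x \<noteq> [] \<Longrightarrow> L_var l x \<le> vec_var x"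
  by (rule L_var_attained(3)) (simp_all add: d_ham_def)

lemma L_var_0: "x \<noteq> [] \<Longrightarrow> L_var 0 x = vec_var x"
  by (simp add: L_var_attained(1) vec_var_ssd)

lemma L_bar_le_vec_var: "x \<noteq> [] \<Longrightarrow> L_bar l x \<le> vec_var x"
  by (simp add: L_bar_def L_var_le_vec_var vec_var_nonneg)

text \<open>An optimal competitor for \<open>x\<close> at level \<open>l\<close> is within distance
  l + 1 of \<open>x'\<close>. Where the level passes 100, the value 0 lies below every lower
  bound.\<close>

lemma L_bar_neighbour:
  assumes "x \<noteq> []" "length x' = length x" "d_ham x x' \<le> 1"
  shows "L_bar (Suc l) x' \<le> L_bar l x"
proof (cases "Suc l \<le> 100")
  case True
  obtain y where y: "length y = length x" "d_ham x y \<le> l" "vec_var y = L_var l x"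
    using L_var_attained(2)[OF assms(1)] by blast
  have "d_ham x' y \<le> Suc l"
    using d_ham_triangle[of x' x y] d_ham_commute[of x x'] assms y by simp
  then have "L_var (Suc l) x' \<le> vec_var y" using assms y by (intro L_var_attained(3)) auto
  then show ?thesis using True y(3) by (simp add: L_bar_def)
next
  case False
  then show ?thesis using L_var_nonneg[OF assms(1)] by (simp add: L_bar_def)
qed

text \<open>Measure the deviations of \<open>x'\<close> from the mean \<open>c\<close> of
  \<open>x\<close>: the shared entries contribute no more than in \<open>x\<close>, and the at most
  one new entry contributes at most (b - a) squared, since \<open>c\<close> also lies in the
  interval.\<close>

lemma vec_var_neighbour:
  assumes "x \<noteq> []" "length x' = length x" "d_ham x x' \<le> 1"
    and x: "set x \<subseteq> {a..b}" and x': "set x' \<subseteq> {a..b}"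
  shows "vec_var x' \<le> vec_var x + (b - a)\<^sup>2 / real (length x)"
proof -
  have n: "real (length x) > 0" using assms(1) by simp
  obtain A where A: "A \<subseteq># mset x" "A \<subseteq># mset x'" "length x \<le> size A + d_ham x x'"
    using d_ham_common[OF assms(2)[symmetric]] by blast
  obtain B where B: "mset x' = A + B" using A(2) by (auto simp: mset_subset_eq_exists_conv)
  have "size B \<le> 1"
    using A(3) assms(2,3) arg_cong[OF B, of size] by simp
  define c where "c = (\<Sum>y\<in>#mset x. y) / real (size (mset x))"
  have "(\<Sum>i<length x. a) \<le> (\<Sum>i<length x. x ! i)" "(\<Sum>i<length x. x ! i) \<le> (\<Sum>i<length x. b)"
    using x by (intro sum_mono; force)+
  moreover have "c = (\<Sum>i<length x. x ! i) / real (length x)"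
    unfolding c_def sum_mset_mset_nth by simp
  ultimately have c: "a \<le> c" "c \<le> b"
    by (simp_all add: pos_le_divide_eq[OF n] pos_divide_le_eq[OF n] mult.commute del: of_nat_0_less_iff)
  have "sq_dev B c \<le> (b - a)\<^sup>2"
  proof (cases "B = {#}")
    case True then show ?thesis by (simp add: sq_dev_def)
  next
    case False
    then have "size B = 1" using \<open>size B \<le> 1\<close> by (simp add: nonempty_has_size)
    then obtain y where y: "B = {#y#}" using size_1_singleton_mset by blast
    then have "y \<in># mset x'" by (simp add: B)
    then have "y \<in> set x'" by simp
    then have "\<bar>y - c\<bar> \<le> \<bar>b - a\<bar>" using x' c by force
    then show ?thesis using y by (simp add: sq_dev_def abs_le_square_iff)
  qed
  moreover have "ssd (mset x') \<le> sq_dev A c + sq_dev B c"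
    using ssd_le_sq_dev[of "mset x'" c] B by (simp add: sq_dev_union)
  moreover have "sq_dev A c \<le> ssd (mset x)"
    using A(1) by (simp add: ssd_eq_sq_dev_mean c_def sq_dev_mono)
  ultimately have "ssd (mset x') \<le> ssd (mset x) + (b - a)\<^sup>2" by simp
  then show ?thesis using n assms(2) by (simp add: vec_var_ssd divide_right_mono flip: add_divide_distrib)
qed

lemma U_bar_0: "U_bar D 0 x = ereal (vec_var x)"
  by (cases D) simp_all

lemma vec_var_le_U_bar: "ereal (vec_var x) \<le> U_bar D l x"
  by (cases D) simp_all

lemma U_bar_neighbour:
  assumes "x \<in> datasets D n" "x' \<in> datasets D n" "n \<ge> 1" "d_ham x x' \<le> 1"
  shows "U_bar D l x' \<le> U_bar D (Suc l) x"
proof (cases D)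
  case (Interval a b)
  then have "vec_var x' \<le> vec_var x + (b - a)\<^sup>2 / real (length x)"
    using assms by (intro vec_var_neighbour) (auto simp: datasets_def)
  then show ?thesis using Interval assms by (simp add: datasets_def add_divide_distrib distrib_right)
qed simp

section \<open>Lengths and queries of neighbouring datasets\<close>

lemma len_bar_le:
  "L_bar l x \<le> t \<Longrightarrow> ereal t \<le> U_bar D l x \<Longrightarrow> len_bar D x t \<le> enat l"
  unfolding len_bar_def by (rule Inf_lower) auto

lemma len_bar_attained:
  assumes "len_bar D x t = enat l"
  shows "L_bar l x \<le> t" "ereal t \<le> U_bar D l x"
proof -
  let ?S = "{enat l | l. ereal (L_bar l x) \<le> ereal t \<and> ereal t \<le> U_bar D l x}"
  have "?S \<noteq> {}"
  proof
    assume "?S = {}"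
    then have "len_bar D x t = \<infinity>" by (simp only: len_bar_def Inf_enat_def if_True refl)
    then show False using assms by simp
  qed
  then have "Inf ?S \<in> ?S" unfolding Inf_enat_def by (auto intro: LeastI)
  then show "L_bar l x \<le> t" "ereal t \<le> U_bar D l x" using assms by (auto simp: len_bar_def)
qed

lemma len_bar_eqI:
  assumes "L_bar l x \<le> t" "ereal t \<le> U_bar D l x"
    and "\<And>j. L_bar j x \<le> t \<Longrightarrow> ereal t \<le> U_bar D j x \<Longrightarrow> l \<le> j"
  shows "len_bar D x t = enat l"
  unfolding len_bar_def by (rule cInf_eq_minimum) (use assms in auto)

lemma len_bar_neighbour:
  assumes "x \<in> datasets D n" "x' \<in> datasets D n" "n \<ge> 1" "d_ham x x' \<le> 1"
  shows "len_bar D x' t \<le> eSuc (len_bar D x t)"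
proof (cases "len_bar D x t")
  case (enat l)
  have "L_bar (Suc l) x' \<le> L_bar l x"
    by (rule L_bar_neighbour) (use assms in \<open>auto simp: datasets_def\<close>)
  moreover have "U_bar D l x \<le> U_bar D (Suc l) x'"
    by (rule U_bar_neighbour) (use assms in \<open>auto simp: datasets_def d_ham_commute\<close>)
  ultimately have "len_bar D x' t \<le> enat (Suc l)"
    using len_bar_attained[OF enat] by (intro len_bar_le) (auto intro: order_trans)
  then show ?thesis using enat by (simp add: eSuc_enat)
qed simp

text \<open>Raising the level from 0 to 1 already makes the bounds of either dataset reach the
  variance of the other, hence enclose everything between the two variances.\<close>

lemma len_bar_crossing:
  assumes "x \<in> datasets D n" "x' \<in> datasets D n" "n \<ge> 1" "d_ham x x' \<le> 1"
    and t: "vec_var x \<le> t" "t \<le> vec_var x'"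
  shows "len_bar D x t \<le> enat 1" "len_bar D x' t \<le> enat 1"
proof -
  have ne: "x \<noteq> []" "x' \<noteq> []" "length x' = length x" using assms by (auto simp: datasets_def)
  have "ereal (vec_var x') \<le> U_bar D 1 x"
    using U_bar_neighbour[OF assms(1-4), of 0] by (simp add: U_bar_0)
  then show "len_bar D x t \<le> enat 1"
    using t L_bar_le_vec_var[OF ne(1), of 1] by (intro len_bar_le) (auto intro: order_trans[of _ "ereal (vec_var x')"])
  have "L_bar 1 x' \<le> vec_var x"
    using L_bar_neighbour[OF ne(1,3) assms(4), of 0] ne(1) by (simp add: L_bar_def L_var_0)
  then show "len_bar D x' t \<le> enat 1"
    using t vec_var_le_U_bar[of x' D 1] by (intro len_bar_le) (auto intro: order_trans[of _ "ereal (vec_var x')"])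
qed

lemma rho_bar_eq:
  "rho_bar D x t =
     (if t < vec_var x then ereal (1 / 2) - ereal_of_enat (len_bar D x t)
      else if vec_var x < t then ereal_of_enat (len_bar D x t) - ereal (1 / 2) else 0)"
  by (cases "len_bar D x t") (auto simp: rho_bar_def)

text \<open>With equal signs the length changes by at most one. With different signs both lengths
  are at most 1, so the value at \<open>x\<close> is at most 1/2 and the one at \<open>x'\<close> at
  least -1/2. An infinite length occurs at both datasets or at neither.\<close>

lemma rho_bar_sensitivity:
  assumes "x \<in> datasets D n" "x' \<in> datasets D n" "n \<ge> 1" "d_ham x x' \<le> 1"
  shows "rho_bar D x t \<le> rho_bar D x' t + 1"
proof -
  let ?l = "len_bar D x t" and ?l' = "len_bar D x' t"
  have sym: "d_ham x' x \<le> 1" using assms by (auto simp: datasets_def d_ham_commute)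
  have 1: "?l' \<le> eSuc ?l" "?l \<le> eSuc ?l'"
    using len_bar_neighbour[OF assms] len_bar_neighbour[OF assms(2,1,3) sym] by auto
  have 2: "vec_var x \<le> t \<Longrightarrow> t \<le> vec_var x' \<Longrightarrow> ?l \<le> enat 1 \<and> ?l' \<le> enat 1"
    using len_bar_crossing[OF assms] by simp
  show ?thesis
    using 1 2 unfolding rho_bar_eq
    by (cases ?l; cases ?l') (auto simp: eSuc_enat zero_ereal_def one_ereal_def)
qed

text \<open>Below the variance the upper bound holds at every level, so the length is the first
  level whose lower bound is at most \<open>t\<close>. The value l = 101 covers the case that none
  of the computed levels qualifies: there \<open>L_bar\<close> is 0, and t is nonnegative.\<close>

lemma rho_bar_below:
  assumes "x \<noteq> []" "0 \<le> t" "t < vec_var x" "l \<le> 101"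
    and "\<And>j. j < l \<Longrightarrow> t < L_var j x" "l \<le> 100 \<Longrightarrow> L_var l x \<le> t"
  shows "rho_bar D x t = ereal (1 / 2 - real l)"
proof -
  have "len_bar D x t = enat l"
  proof (rule len_bar_eqI)
    show "L_bar l x \<le> t" using assms by (auto simp: L_bar_def)
    show "ereal t \<le> U_bar D l x"
      using vec_var_le_U_bar[of x D l] assms(3) by (meson ereal_less_eq(3) less_imp_le order_trans)
    show "l \<le> j" if "L_bar j x \<le> t" for j
      using that assms(4) assms(5)[of j] by (cases "j \<le> 100") (auto simp: L_bar_def not_less[symmetric])
  qed
  then show ?thesis using assms(3) by (simp add: rho_bar_eq)
qed

lemma rho_bar_at: "rho_bar D x (vec_var x) = 0"
  by (simp add: rho_bar_def flip: zero_ereal_def)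

text \<open>Above the variance the lower bound holds at every level, and the upper bound is linear
  in the level, so the first admissible level is a ceiling.\<close>

lemma rho_bar_above_Interval:
  assumes "x \<noteq> []" "vec_var x < t" "a < b"
  shows "rho_bar (Interval a b) x t =
     ereal (of_int \<lceil>real (length x) * (t - vec_var x) / (b - a)\<^sup>2\<rceil> - 1 / 2)"
proof -
  let ?r = "real (length x) * (t - vec_var x) / (b - a)\<^sup>2"
  have n: "real (length x) > 0" using assms(1) by simp
  have U: "ereal t \<le> U_bar (Interval a b) l x \<longleftrightarrow> ?r \<le> real l" for l
    using n assms(3) by (simp add: field_simps)
  have r: "?r \<ge> 0" using assms by simp
  have "len_bar (Interval a b) x t = enat (nat \<lceil>?r\<rceil>)"
  proof (rule len_bar_eqI)
    show "L_bar (nat \<lceil>?r\<rceil>) x \<le> t"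
      using L_bar_le_vec_var[OF assms(1)] assms(2) by (meson less_imp_le order_trans)
    show "ereal t \<le> U_bar (Interval a b) (nat \<lceil>?r\<rceil>) x" unfolding U by linarith
    show "nat \<lceil>?r\<rceil> \<le> j" if "ereal t \<le> U_bar (Interval a b) j x" for j
      using that unfolding U by linarith
  qed
  moreover have "real (nat \<lceil>?r\<rceil>) = of_int \<lceil>?r\<rceil>" using r by simp
  ultimately show ?thesis using assms(2) by (simp add: rho_bar_eq)
qed

lemma rho_bar_above_RealLine:
  assumes "x \<noteq> []" "vec_var x < t"
  shows "rho_bar RealLine x t = ereal (1 / 2)"
proof -
  have "len_bar RealLine x t = enat 1"
  proof (rule len_bar_eqI)
    show "L_bar 1 x \<le> t"
      using L_bar_le_vec_var[OF assms(1)] assms(2) by (meson less_imp_le order_trans)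
    show "1 \<le> j" if "ereal t \<le> U_bar RealLine j x" for j
      using that assms(2) by (cases j) auto
  qed simp
  then show ?thesis using assms(2) by (simp add: rho_bar_eq)
qed

section \<open>Privacy of AboveThreshold\<close>

lemma above_threshold_eq_Some:
  "above_threshold x q T (Z, \<nu>) = Some k \<longleftrightarrow>
     1 \<le> k \<and> ereal (T + Z) \<le> q k x + ereal (\<nu> k) \<and>
     (\<forall>i\<in>{1..<k}. q i x + ereal (\<nu> i) < ereal (T + Z))"
proof -
  define P where "P = (\<lambda>i. 1 \<le> i \<and> ereal (T + Z) \<le> q i x + ereal (\<nu> i))"
  have "above_threshold x q T (Z, \<nu>) = (if Ex P then Some (Least P) else None)"
    by (simp add: above_threshold_def P_def Let_def)
  moreover have "Ex P \<and> Least P = k \<longleftrightarrow> P k \<and> (\<forall>i<k. \<not> P i)"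
    using LeastI_ex[of P] not_less_Least[of _ P] Least_equality[of P k] leI by blast
  ultimately have "above_threshold x q T (Z, \<nu>) = Some k \<longleftrightarrow> P k \<and> (\<forall>i<k. \<not> P i)"
    by (cases "Ex P") auto
  then show ?thesis
    unfolding P_def not_le[symmetric, where 'a = ereal] Ball_def atLeastLessThan_iff by blast
qed

lemma above_threshold_eq_None:
  "above_threshold x q T (Z, \<nu>) = None \<longleftrightarrow>
     (\<forall>i\<ge>1. q i x + ereal (\<nu> i) < ereal (T + Z))"
proof -
  have "above_threshold x q T (Z, \<nu>) = None \<longleftrightarrow>
      \<not> (\<exists>i\<ge>1. ereal (T + Z) \<le> q i x + ereal (\<nu> i))"
    by (simp add: above_threshold_def Let_def)
  then show ?thesis unfolding not_le[symmetric] by blast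
qed

section \<open>Shifts of exponential noise\<close>

lemma prob_space_exponential: "s > 0 \<Longrightarrow> prob_space (exponential s)"
  unfolding exponential_def by (rule prob_space_exponential_density) simp

lemma sets_exponential [measurable_cong]: "sets (exponential s) = sets borel"
  by (simp add: exponential_def)

text \<open>For z at least 0 the density at z equals exp (c / s) times the density at z + c, and for
  negative z it is 0. The inequality then follows by translation. It relies on c being nonnegative:
  a downward shift would leave the support.\<close>

lemma nn_integral_exponential_shift:
  assumes [measurable]: "f \<in> borel_measurable borel" and "s > 0" "c \<ge> 0"
  shows "(\<integral>\<^sup>+z. f z \<partial>exponential s) \<le>
    ennreal (exp (c / s)) * (\<integral>\<^sup>+z. f (z - c) \<partial>exponential s)"
proof -
  let ?d = "\<lambda>z. ennreal (exponential_density (1 / s) z)"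
  have [measurable]: "exponential_density l \<in> borel_measurable borel" for l
    unfolding exponential_density_def by measurable
  have d: "?d z \<le> ennreal (exp (c / s)) * ?d (c + z)" for z
    using assms(2,3)
    by (simp add: exponential_density_def add_divide_distrib field_simps flip: ennreal_mult exp_add)
  have "(\<integral>\<^sup>+z. f z \<partial>exponential s) = (\<integral>\<^sup>+z. ?d z * f z \<partial>lborel)"
    unfolding exponential_def by (simp add: nn_integral_density)
  also have "\<dots> \<le> (\<integral>\<^sup>+z. ennreal (exp (c / s)) * (?d (c + z) * f z) \<partial>lborel)"
    using d by (intro nn_integral_mono) (simp add: mult.assoc[symmetric] mult_right_mono)
  also have "\<dots> = ennreal (exp (c / s)) * (\<integral>\<^sup>+z. ?d (c + z) * f z \<partial>lborel)"
    by (rule nn_integral_cmult) measurable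
  also have "(\<integral>\<^sup>+z. ?d (c + z) * f z \<partial>lborel) = (\<integral>\<^sup>+z. ?d z * f (z - c) \<partial>lborel)"
    using nn_integral_real_affine[of "\<lambda>z. ?d z * f (z - c)" 1 c] by simp
  also have "\<dots> = (\<integral>\<^sup>+z. f (z - c) \<partial>exponential s)"
    unfolding exponential_def by (simp add: nn_integral_density)
  finally show ?thesis .
qed

lemma measurable_PiM_shift [measurable (raw)]:
  assumes "k \<in> I"
  shows "(\<lambda>X. X(k := X k - c)) \<in> (\<Pi>\<^sub>M i\<in>I. exponential s) \<rightarrow>\<^sub>M (\<Pi>\<^sub>M i\<in>I. exponential s)"
proof (rule measurable_PiM_single')
  show "(\<lambda>X. (X(k := X k - c)) i) \<in> (\<Pi>\<^sub>M i\<in>I. exponential s) \<rightarrow>\<^sub>M exponential s" if "i \<in> I" for i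
    using that assms by (cases "i = k") auto
  show "(\<lambda>X i. (X(k := X k - c)) i) \<in> space (\<Pi>\<^sub>M i\<in>I. exponential s) \<rightarrow> (\<Pi>\<^sub>E i\<in>I. space (exponential s))"
    using assms by (auto simp: space_PiM exponential_def PiE_iff extensional_def)
qed

text \<open>The product is split into coordinate \<open>k\<close> and the remaining coordinates; for
  fixed remaining ones the one-dimensional shift applies to the inner integral.\<close>

lemma nn_integral_PiM_exponential_shift:
  assumes f: "f \<in> borel_measurable (\<Pi>\<^sub>M i\<in>I. exponential s)" and "k \<in> I" "s > 0" "c \<ge> 0"
  shows "(\<integral>\<^sup>+X. f X \<partial>(\<Pi>\<^sub>M i\<in>I. exponential s)) \<le>
    ennreal (exp (c / s)) * (\<integral>\<^sup>+X. f (X(k := X k - c)) \<partial>(\<Pi>\<^sub>M i\<in>I. exponential s))"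
proof -
  let ?E = "exponential s" and ?P = "\<Pi>\<^sub>M i\<in>I. exponential s"
  let ?R = "\<Pi>\<^sub>M i\<in>I - {k}. exponential s"
  note [measurable] = f
  interpret E: prob_space ?E by (rule prob_space_exponential) fact
  interpret R: prob_space ?R by (rule prob_space_PiM) (rule E.prob_space_axioms)
  interpret pair_sigma_finite ?E ?R ..
  have split: "distr (?E \<Otimes>\<^sub>M ?R) ?P (\<lambda>(v, X). X(k := v)) = ?P"
    using distr_pair_PiM_eq_PiM[of "I - {k}" "\<lambda>_. ?E" k] E.prob_space_axioms
    by (simp add: insert_absorb[OF assms(2)])
  have [measurable]: "(\<lambda>(v, X). X(k := v)) \<in> ?E \<Otimes>\<^sub>M ?R \<rightarrow>\<^sub>M ?P"
    using measurable_compose[OF measurable_pair_swap' measurable_add_dim[of k "I - {k}" "\<lambda>_. ?E"]]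
    by (simp add: insert_absorb[OF assms(2)] split_beta')
  have *: "(\<integral>\<^sup>+X. g X \<partial>?P) = (\<integral>\<^sup>+X. \<integral>\<^sup>+v. g (X(k := v)) \<partial>?E \<partial>?R)"
    if [measurable]: "g \<in> borel_measurable ?P" for g
  proof -
    have "(\<integral>\<^sup>+X. g X \<partial>?P) = (\<integral>\<^sup>+w. g ((\<lambda>(v, X). X(k := v)) w) \<partial>(?E \<Otimes>\<^sub>M ?R))"
      by (subst split[symmetric], subst nn_integral_distr) auto
    also have "\<dots> = (\<integral>\<^sup>+X. \<integral>\<^sup>+v. g (X(k := v)) \<partial>?E \<partial>?R)"
      by (subst nn_integral_snd[symmetric]) auto
    finally show ?thesis .
  qed
  have "(\<integral>\<^sup>+X. f X \<partial>?P) = (\<integral>\<^sup>+X. \<integral>\<^sup>+v. f (X(k := v)) \<partial>?E \<partial>?R)" by (rule *) fact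
  also have "\<dots> \<le> (\<integral>\<^sup>+X. ennreal (exp (c / s)) * (\<integral>\<^sup>+v. f (X(k := v - c)) \<partial>?E) \<partial>?R)"
  proof (intro nn_integral_mono nn_integral_exponential_shift)
    fix X assume X: "X \<in> space ?R"
    have "(\<lambda>v. f ((\<lambda>(v, X). X(k := v)) (v, X))) \<in> borel_measurable ?E"
      using X by measurable
    then show "(\<lambda>v. f (X(k := v))) \<in> borel_measurable borel"
      by (simp cong: measurable_cong_sets add: sets_exponential)
  qed (use assms in simp_all)
  also have "\<dots> = ennreal (exp (c / s)) * (\<integral>\<^sup>+X. \<integral>\<^sup>+v. f (X(k := v - c)) \<partial>?E \<partial>?R)"
  proof (rule nn_integral_cmult)
    have "(\<lambda>X. \<integral>\<^sup>+v. f ((\<lambda>(v, X). X(k := v)) (v - c, X)) \<partial>?E) \<in> borel_measurable ?R"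
      by measurable
    then show "(\<lambda>X. \<integral>\<^sup>+v. f (X(k := v - c)) \<partial>?E) \<in> borel_measurable ?R" by simp
  qed
  also have "(\<integral>\<^sup>+X. \<integral>\<^sup>+v. f (X(k := v - c)) \<partial>?E \<partial>?R) = (\<integral>\<^sup>+X. f (X(k := X k - c)) \<partial>?P)"
    using measurable_compose[OF measurable_PiM_shift[OF assms(2)] f] by (subst *) simp_all
  finally show ?thesis .
qed

text \<open>First \<open>\<nu>\<close> is shifted in the inner integral; exchanging the order of
  integration then makes \<open>Z\<close> the inner variable, so that it can be shifted in turn. The
  two factors multiply.\<close>

lemma nn_integral_above_threshold_noise_shift:
  assumes f: "f \<in> borel_measurable (above_threshold_noise \<Delta> eps1 eps2)"
    and k: "k \<ge> 1" and pos: "\<Delta> > 0" "eps1 > 0" "eps2 > 0" and c: "a \<ge> 0" "c \<ge> 0"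
  shows "(\<integral>\<^sup>+w. f w \<partial>above_threshold_noise \<Delta> eps1 eps2) \<le>
    ennreal (exp (a * eps1 / \<Delta> + c * eps2 / \<Delta>)) *
      (\<integral>\<^sup>+(Z, \<nu>). f (Z - a, \<nu>(k := \<nu> k - c)) \<partial>above_threshold_noise \<Delta> eps1 eps2)"
proof -
  let ?E = "exponential (\<Delta> / eps1)" and ?P = "\<Pi>\<^sub>M i\<in>{1::nat..}. exponential (\<Delta> / eps2)"
  note [measurable] = f[unfolded above_threshold_noise_def]
  have [measurable]: "(\<lambda>X. X(k := X k - c)) \<in> ?P \<rightarrow>\<^sub>M ?P"
    using k by (intro measurable_PiM_shift) simp
  have [measurable]: "(\<lambda>Z. Z - a) \<in> ?E \<rightarrow>\<^sub>M ?E" by measurable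
  interpret E: prob_space ?E by (rule prob_space_exponential) (use pos in simp)
  interpret N: prob_space ?P by (rule prob_space_PiM, rule prob_space_exponential) (use pos in simp)
  interpret pair_sigma_finite ?E ?P ..
  have "(\<integral>\<^sup>+w. f w \<partial>(?E \<Otimes>\<^sub>M ?P)) = (\<integral>\<^sup>+Z. \<integral>\<^sup>+\<nu>. f (Z, \<nu>) \<partial>?P \<partial>?E)"
    by (rule N.nn_integral_fst[symmetric]) measurable
  also have "\<dots> \<le> (\<integral>\<^sup>+Z. ennreal (exp (c * eps2 / \<Delta>)) * (\<integral>\<^sup>+\<nu>. f (Z, \<nu>(k := \<nu> k - c)) \<partial>?P) \<partial>?E)"
  proof (rule nn_integral_mono)
    fix Z assume "Z \<in> space ?E"
    then have "(\<lambda>\<nu>. f (Z, \<nu>)) \<in> borel_measurable ?P" by measurable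
    from nn_integral_PiM_exponential_shift[OF this, of k c]
    show "(\<integral>\<^sup>+\<nu>. f (Z, \<nu>) \<partial>?P) \<le> ennreal (exp (c * eps2 / \<Delta>)) * (\<integral>\<^sup>+\<nu>. f (Z, \<nu>(k := \<nu> k - c)) \<partial>?P)"
      using k pos c by simp
  qed
  also have "\<dots> = ennreal (exp (c * eps2 / \<Delta>)) * (\<integral>\<^sup>+Z. \<integral>\<^sup>+\<nu>. f (Z, \<nu>(k := \<nu> k - c)) \<partial>?P \<partial>?E)"
    by (rule nn_integral_cmult) measurable
  finally have 1: "(\<integral>\<^sup>+w. f w \<partial>(?E \<Otimes>\<^sub>M ?P)) \<le> ennreal (exp (c * eps2 / \<Delta>)) *
      (\<integral>\<^sup>+Z. \<integral>\<^sup>+\<nu>. f (Z, \<nu>(k := \<nu> k - c)) \<partial>?P \<partial>?E)" .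
  have "(\<integral>\<^sup>+Z. \<integral>\<^sup>+\<nu>. f (Z, \<nu>(k := \<nu> k - c)) \<partial>?P \<partial>?E) =
      (\<integral>\<^sup>+\<nu>. \<integral>\<^sup>+Z. f (Z, \<nu>(k := \<nu> k - c)) \<partial>?E \<partial>?P)"
    by (rule Fubini'[symmetric]) measurable
  also have "\<dots> \<le> (\<integral>\<^sup>+\<nu>. ennreal (exp (a * eps1 / \<Delta>)) * (\<integral>\<^sup>+Z. f (Z - a, \<nu>(k := \<nu> k - c)) \<partial>?E) \<partial>?P)"
  proof (rule nn_integral_mono)
    fix \<nu> assume [measurable]: "\<nu> \<in> space ?P"
    have "(\<lambda>Z. f (Z, \<nu>(k := \<nu> k - c))) \<in> borel_measurable ?E" by measurable
    then have "(\<lambda>Z. f (Z, \<nu>(k := \<nu> k - c))) \<in> borel_measurable borel"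
      by (simp cong: measurable_cong_sets add: sets_exponential)
    from nn_integral_exponential_shift[OF this, of "\<Delta> / eps1" a]
    show "(\<integral>\<^sup>+Z. f (Z, \<nu>(k := \<nu> k - c)) \<partial>?E) \<le>
        ennreal (exp (a * eps1 / \<Delta>)) * (\<integral>\<^sup>+Z. f (Z - a, \<nu>(k := \<nu> k - c)) \<partial>?E)"
      using pos c by simp
  qed
  also have "\<dots> = ennreal (exp (a * eps1 / \<Delta>)) * (\<integral>\<^sup>+\<nu>. \<integral>\<^sup>+Z. f (Z - a, \<nu>(k := \<nu> k - c)) \<partial>?E \<partial>?P)"
    by (rule nn_integral_cmult) measurable
  also have "(\<integral>\<^sup>+\<nu>. \<integral>\<^sup>+Z. f (Z - a, \<nu>(k := \<nu> k - c)) \<partial>?E \<partial>?P) =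
      (\<integral>\<^sup>+(Z, \<nu>). f (Z - a, \<nu>(k := \<nu> k - c)) \<partial>(?E \<Otimes>\<^sub>M ?P))"
  proof -
    have "(\<lambda>(Z, \<nu>). f (Z - a, \<nu>(k := \<nu> k - c))) \<in> borel_measurable (?E \<Otimes>\<^sub>M ?P)"
      by measurable
    from nn_integral_snd[OF this] show ?thesis by simp
  qed
  finally have "ennreal (exp (c * eps2 / \<Delta>)) *
      (\<integral>\<^sup>+Z. \<integral>\<^sup>+\<nu>. f (Z, \<nu>(k := \<nu> k - c)) \<partial>?P \<partial>?E) \<le>
      ennreal (exp (c * eps2 / \<Delta>)) * (ennreal (exp (a * eps1 / \<Delta>)) *
        (\<integral>\<^sup>+(Z, \<nu>). f (Z - a, \<nu>(k := \<nu> k - c)) \<partial>(?E \<Otimes>\<^sub>M ?P)))"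
    by (rule mult_left_mono) simp
  with 1 show ?thesis
    unfolding above_threshold_noise_def exp_add
    by (simp only: ennreal_mult exp_ge_zero mult.assoc mult.left_commute)
qed

text \<open>The outcomes are countable, so preimages of singletons suffice, and each is a countable
  combination of comparisons of noise variables.\<close>

lemma measurable_above_threshold:
  "above_threshold x q T \<in> above_threshold_noise \<Delta> eps1 eps2 \<rightarrow>\<^sub>M count_space UNIV"
proof -
  let ?N = "above_threshold_noise \<Delta> eps1 eps2"
  have [measurable]: "fst \<in> borel_measurable ?N"
    unfolding above_threshold_noise_def by measurable
  have [measurable]: "(\<lambda>w. snd w i) \<in> borel_measurable ?N" if "1 \<le> i" for i
    using that unfolding above_threshold_noise_def
    by (intro measurable_compose[OF measurable_snd])
      (simp add: measurable_component_singleton cong: measurable_cong_sets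
         flip: sets_exponential[of "\<Delta> / eps2"])
  have [measurable]: "Measurable.pred ?N (\<lambda>w. q i x + ereal (snd w i) < ereal (T + fst w))"
    if "1 \<le> i" for i
    using that by measurable
  have *: "Measurable.pred ?N (\<lambda>w. above_threshold x q T w = r)" for r
  proof (cases r)
    case None
    have "Measurable.pred ?N (\<lambda>w. \<forall>i\<in>{1..}. q i x + ereal (snd w i) < ereal (T + fst w))"
      by (rule pred_intros_countable_bounded) simp_all
    then show ?thesis
      by (simp add: None above_threshold_eq_None[of x q T "fst w" "snd w" for w, simplified] Ball_def)
  next
    case (Some k)
    show ?thesis
    proof (cases "1 \<le> k")
      case True
      have "Measurable.pred ?N (\<lambda>w. \<not> (q k x + ereal (snd w k) < ereal (T + fst w)) \<and>
          (\<forall>i\<in>{1..<k}. q i x + ereal (snd w i) < ereal (T + fst w)))"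
        using True by (intro pred_intros_logic pred_intros_finite) simp_all
      then show ?thesis
        using True above_threshold_eq_Some[of x q T "fst w" "snd w" k for w]
        by (simp add: Some not_less)
    next
      case False
      then show ?thesis
        using above_threshold_eq_Some[of x q T "fst w" "snd w" k for w] by (simp add: Some)
    qed
  qed
  have "above_threshold x q T -` {r} \<inter> space ?N \<in> sets ?N" for r
    using measurable_sets[OF *[of r], of "{True}"] by (simp add: vimage_def)
  then show ?thesis by (simp add: measurable_count_space_eq2_countable)
qed

lemma prob_space_above_threshold_noise:
  assumes "\<Delta> > 0" "eps1 > 0" "eps2 > 0"
  shows "prob_space (above_threshold_noise \<Delta> eps1 eps2)"
proof -
  show ?thesis unfolding above_threshold_noise_def using assms
    by (intro prob_space_pair prob_space_PiM prob_space_exponential) simp_all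
qed

text \<open>
  Raising the threshold noise by \<open>\<Delta>\<close> keeps all earlier answers on \<open>x'\<close> below the threshold;
  raising \<open>\<nu>\<^sub>k\<close> by \<open>2 \<Delta>\<close> then keeps the \<open>k\<close>-th answer above it.
\<close>

lemma above_threshold_neighbour:
  assumes sens: "\<And>i. i \<ge> 1 \<Longrightarrow> q i x \<le> q i x' + ereal \<Delta>" "\<And>i. i \<ge> 1 \<Longrightarrow> q i x' \<le> q i x + ereal \<Delta>"
  shows "above_threshold x q T (Z - \<Delta>, \<nu>(k := \<nu> k - 2 * \<Delta>)) = Some k \<Longrightarrow>
      above_threshold x' q T (Z, \<nu>) = Some k"
    and "above_threshold x q T (Z - \<Delta>, \<nu>) = None \<Longrightarrow> above_threshold x' q T (Z, \<nu>) = None"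
proof -
  have low: "q i x' + ereal v < ereal (T + Z)"
    if "i \<ge> 1" "q i x + ereal v < ereal (T + (Z - \<Delta>))" for i v
    using that(2) sens(2)[OF that(1)] by (cases "q i x"; cases "q i x'") auto
  have high: "ereal (T + Z) \<le> q k x' + ereal v"
    if "k \<ge> 1" "ereal (T + (Z - \<Delta>)) \<le> q k x + ereal (v - 2 * \<Delta>)" for v
    using that(2) sens(1)[OF that(1)] by (cases "q k x"; cases "q k x'") auto
  show "above_threshold x' q T (Z, \<nu>) = Some k"
    if "above_threshold x q T (Z - \<Delta>, \<nu>(k := \<nu> k - 2 * \<Delta>)) = Some k"
    using that low high unfolding above_threshold_eq_Some by auto
  show "above_threshold x' q T (Z, \<nu>) = None" if "above_threshold x q T (Z - \<Delta>, \<nu>) = None"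
    using that low unfolding above_threshold_eq_None by auto
qed

text \<open>Single outcomes are compared through the noise shift and then summed over
  \<open>A\<close>. Raising \<open>Z\<close> by \<open>\<Delta>\<close> costs eps1, and raising the
  accepted noise by twice \<open>\<Delta>\<close> costs 2 * eps2.\<close>

lemma above_threshold_private:
  assumes sens: "\<And>i. i \<ge> 1 \<Longrightarrow> q i x \<le> q i x' + ereal \<Delta>" "\<And>i. i \<ge> 1 \<Longrightarrow> q i x' \<le> q i x + ereal \<Delta>"
    and pos: "\<Delta> > 0" "eps1 > 0" "eps2 > 0"
  shows "emeasure (distr (above_threshold_noise \<Delta> eps1 eps2) (count_space UNIV) (above_threshold x q T)) A \<le>
    ennreal (exp (eps1 + 2 * eps2)) *
      emeasure (distr (above_threshold_noise \<Delta> eps1 eps2) (count_space UNIV) (above_threshold x' q T)) A"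
proof -
  let ?N = "above_threshold_noise \<Delta> eps1 eps2"
  let ?D = "\<lambda>x. distr ?N (count_space UNIV) (above_threshold x q T)"
  note [measurable] = measurable_above_threshold
  have em: "emeasure (?D x) {r} = (\<integral>\<^sup>+w. indicator {r} (above_threshold x q T w) \<partial>?N)" for x r
    by (subst nn_integral_indicator[symmetric], simp, subst nn_integral_distr) auto
  have point: "emeasure (?D x) {r} \<le> ennreal (exp (eps1 + 2 * eps2)) * emeasure (?D x') {r}" for r
  proof -
    \<comment> \<open>For \<open>None\<close> no query is accepted: coordinate 1 is a dummy and is
      shifted by 0. The maximum with 1 only provides a valid coordinate for \<open>Some 0\<close>,
      which is never an outcome.\<close>
    define k where "k = (case r of Some k \<Rightarrow> max k 1 | None \<Rightarrow> 1)"
    define c where "c = (if r = None then 0 else 2 * \<Delta>)"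
    have "emeasure (?D x) {r} \<le> ennreal (exp (\<Delta> * eps1 / \<Delta> + c * eps2 / \<Delta>)) *
      (\<integral>\<^sup>+(Z, \<nu>). indicator {r} (above_threshold x q T (Z - \<Delta>, \<nu>(k := \<nu> k - c))) \<partial>?N)"
      unfolding em
      by (rule nn_integral_above_threshold_noise_shift)
        (use pos in \<open>auto simp: k_def c_def split: option.split\<close>)
    also have "\<dots> \<le> ennreal (exp (eps1 + 2 * eps2)) *
        (\<integral>\<^sup>+w. indicator {r} (above_threshold x' q T w) \<partial>?N)"
    proof (intro mult_mono nn_integral_mono ennreal_leI)
      show "exp (\<Delta> * eps1 / \<Delta> + c * eps2 / \<Delta>) \<le> exp (eps1 + 2 * eps2)"
        using pos by (simp add: c_def)
      fix w :: "real \<times> (nat \<Rightarrow> real)"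
      obtain Z \<nu> where w: "w = (Z, \<nu>)" by fastforce
      have "above_threshold x' q T (Z, \<nu>) = r"
        if r: "above_threshold x q T (Z - \<Delta>, \<nu>(k := \<nu> k - c)) = r"
      proof (cases r)
        case None
        then show ?thesis using r above_threshold_neighbour(2)[where q = q and x = x, OF sens] by (simp add: c_def)
      next
        case (Some j)
        with r have "j \<ge> 1" by (simp add: above_threshold_eq_Some)
        then show ?thesis using r Some above_threshold_neighbour(1)[where q = q and x = x and k = j, OF sens, of T Z \<nu>]
          by (simp add: c_def k_def max_def split: if_splits)
      qed
      then show "(case w of (Z, \<nu>) \<Rightarrow> indicator {r} (above_threshold x q T (Z - \<Delta>, \<nu>(k := \<nu> k - c))))
          \<le> (indicator {r} (above_threshold x' q T w) :: ennreal)"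
        by (auto simp: w split: split_indicator)
    qed auto
    finally show ?thesis unfolding em .
  qed
  have "emeasure (?D x) A = (\<integral>\<^sup>+r. emeasure (?D x) {r} \<partial>count_space A)"
    by (rule emeasure_countable_singleton) auto
  also have "\<dots> \<le> (\<integral>\<^sup>+r. ennreal (exp (eps1 + 2 * eps2)) * emeasure (?D x') {r} \<partial>count_space A)"
    by (intro nn_integral_mono point)
  also have "\<dots> = ennreal (exp (eps1 + 2 * eps2)) * emeasure (?D x') A"
    by (subst nn_integral_cmult, simp, subst emeasure_countable_singleton[symmetric]) auto
  finally show ?thesis .
qed

section \<open>From the accepted index to the returned value\<close>

lemma space_output_space [simp]: "space output_space = UNIV"
  by (simp add: output_space_def)

text \<open>The returned number is a function of the accepted index, so privacy passes from the
  discrete outcome to its image by taking preimages of events.\<close>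

lemma var_mechanism_distr:
  "var_mechanism D \<beta> eps1 eps2 x =
     distr (distr (above_threshold_noise 1 eps1 eps2) (count_space UNIV)
         (above_threshold x (\<lambda>i y. rho_bar D y (\<beta> ^ i - 1)) 0))
       output_space (map_option (\<lambda>k. \<beta> ^ k - 1))"
  unfolding var_mechanism_def
  by (subst distr_distr)
    (simp_all add: measurable_above_threshold comp_def var_output_def[abs_def] num_queries_def)

lemma var_mechanism_private:
  assumes n: "n \<ge> 1" and pos: "eps1 > 0" "eps2 > 0"
  shows "differentially_private (datasets D n) output_space (eps1 + 2 * eps2)
    (var_mechanism D \<beta> eps1 eps2)"
proof -
  let ?q = "\<lambda>i y. rho_bar D y (\<beta> ^ i - 1)"
  let ?N = "above_threshold_noise 1 eps1 eps2"
  let ?D = "\<lambda>x. distr ?N (count_space UNIV) (above_threshold x ?q 0)"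
  let ?g = "map_option (\<lambda>k. \<beta> ^ k - 1) :: nat option \<Rightarrow> real option"
  note [measurable] = measurable_above_threshold
  interpret N: prob_space ?N by (rule prob_space_above_threshold_noise) (use pos in simp_all)
  have D: "prob_space (?D x)" for x by (rule N.prob_space_distr) measurable
  then have M: "prob_space (var_mechanism D \<beta> eps1 eps2 x)" for x
    unfolding var_mechanism_distr by (rule prob_space.prob_space_distr) simp
  show ?thesis
    unfolding differentially_private_def
  proof (intro conjI ballI impI)
    fix x assume "x \<in> datasets D n"
    have "sets (var_mechanism D \<beta> eps1 eps2 x) = sets output_space" by (simp add: var_mechanism_def)
    with M show "var_mechanism D \<beta> eps1 eps2 x \<in> space (prob_algebra output_space)"
      by (simp add: space_prob_algebra)
  next
    fix x x' S
    assume x: "x \<in> datasets D n" "x' \<in> datasets D n" "d_ham x x' \<le> 1" and S: "S \<in> sets output_space"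
    have em: "emeasure (var_mechanism D \<beta> eps1 eps2 x) S = emeasure (?D x) (?g -` S)" for x
      unfolding var_mechanism_distr using emeasure_distr[of ?g "?D x" output_space S] S
      by (simp cong: measurable_cong_sets)
    have "d_ham x' x \<le> 1" using x by (simp add: datasets_def d_ham_commute)
    then have "emeasure (?D x) (?g -` S) \<le>
        ennreal (exp (eps1 + 2 * eps2)) * emeasure (?D x') (?g -` S)"
      using rho_bar_sensitivity[of x D n x'] rho_bar_sensitivity[of x' D n x] x n pos
      by (intro above_threshold_private) (simp_all add: one_ereal_def)
    then have "ennreal (measure (var_mechanism D \<beta> eps1 eps2 x) S) \<le>
        ennreal (exp (eps1 + 2 * eps2) * measure (var_mechanism D \<beta> eps1 eps2 x') S)"
      unfolding em[symmetric] finite_measure.emeasure_eq_measure[OF prob_space.finite_measure[OF M]]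
      by (simp add: ennreal_mult)
    then show "measure (var_mechanism D \<beta> eps1 eps2 x) S \<le>
        exp (eps1 + 2 * eps2) * measure (var_mechanism D \<beta> eps1 eps2 x') S"
      by (simp add: ennreal_le_iff)
  qed
qed

section \<open>Weakest preconditions with step counts\<close>

inductive_cases exec_SkipE: "exec u Skip s m s'"
inductive_cases exec_NAssignE: "exec u (NAssign v e) s m s'"
inductive_cases exec_RAssignE: "exec u (RAssign v r) s m s'"
inductive_cases exec_RStoreE: "exec u (RStore e r) s m s'"
inductive_cases exec_DrawE: "exec u (Draw v r) s m s'"
inductive_cases exec_SeqE: "exec u (Seq c1 c2) s m s'"
inductive_cases exec_CondE: "exec u (Cond b c1 c2) s m s'"
inductive_cases exec_WhileE: "exec u (While b c) s m s'"

lemma exec_deterministic: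
  "exec u c s m s' \<Longrightarrow> exec u c s m2 s2 \<Longrightarrow> m2 = m \<and> s2 = s'"
proof (induction arbitrary: m2 s2 rule: exec.induct)
  case Skip then show ?case by (auto elim: exec_SkipE)
next
  case NAssign then show ?case by (auto elim: exec_NAssignE)
next
  case RAssign then show ?case by (auto elim: exec_RAssignE)
next
  case RStore then show ?case by (auto elim: exec_RStoreE)
next
  case Draw then show ?case by (auto elim: exec_DrawE)
next
  case Seq show ?case by (rule exec_SeqE[OF Seq.prems]) (use Seq.IH in blast)
next
  case CondTrue show ?case by (rule exec_CondE[OF CondTrue.prems]) (use CondTrue in blast)+
next
  case CondFalse show ?case by (rule exec_CondE[OF CondFalse.prems]) (use CondFalse in blast)+
next
  case WhileFalse show ?case by (rule exec_WhileE[OF WhileFalse.prems]) (use WhileFalse in auto)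
next
  case WhileTrue show ?case by (rule exec_WhileE[OF WhileTrue.prems]) (use WhileTrue in blast)+
qed

text \<open>Total correctness with the step count visible to the postcondition. The equations below
  turn simplification into symbolic execution of loop-free code; \<open>exec_deterministic\<close>
  permits combining facts about the same run.\<close>

definition wp :: "(nat \<Rightarrow> real) \<Rightarrow> com \<Rightarrow> state \<Rightarrow> (nat \<Rightarrow> state \<Rightarrow> bool) \<Rightarrow> bool" where
  "wp u c s Q \<longleftrightarrow> (\<exists>m s'. exec u c s m s' \<and> Q m s')"

lemma wp_mono: "wp u c s Q \<Longrightarrow> (\<And>m s'. Q m s' \<Longrightarrow> R m s') \<Longrightarrow> wp u c s R"
  unfolding wp_def by blast

lemma wp_conj: "wp u c s Q \<Longrightarrow> wp u c s R \<Longrightarrow> wp u c s (\<lambda>m s'. Q m s' \<and> R m s')"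
  unfolding wp_def using exec_deterministic by blast

lemma wp_Skip [simp]: "wp u Skip s Q = Q 1 s"
  unfolding wp_def by (force intro: exec.Skip elim: exec_SkipE)

lemma wp_NAssign [simp]: "wp u (NAssign v e) s Q = Q 1 (s\<lparr>nreg := (nreg s)(v := nval e s)\<rparr>)"
  unfolding wp_def by (force intro: exec.NAssign elim: exec_NAssignE)

lemma wp_RAssign [simp]: "wp u (RAssign v r) s Q = Q 1 (s\<lparr>rreg := (rreg s)(v := rval r s)\<rparr>)"
  unfolding wp_def by (force intro: exec.RAssign elim: exec_RAssignE)

lemma wp_RStore [simp]: "wp u (RStore e r) s Q = Q 1 (s\<lparr>mem := (mem s)(nval e s := rval r s)\<rparr>)"
  unfolding wp_def by (force intro: exec.RStore elim: exec_RStoreE)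

lemma wp_Draw [simp]: "wp u (Draw v r) s Q = Q 1
    (s\<lparr>rreg := (rreg s)(v := rval r s * u (draws s)), draws := Suc (draws s)\<rparr>)"
  unfolding wp_def by (force intro: exec.Draw elim: exec_DrawE)

lemma wp_Seq [simp]: "wp u (Seq c1 c2) s Q = wp u c1 s (\<lambda>m1 s1. wp u c2 s1 (\<lambda>m2. Q (m1 + m2)))"
  unfolding wp_def by (blast intro: exec.Seq elim: exec_SeqE)

lemma wp_Cond [simp]: "wp u (Cond b c1 c2) s Q = wp u (if bval b s then c1 else c2) s (\<lambda>m. Q (Suc m))"
  unfolding wp_def
  by (cases "bval b s") (simp_all, (blast intro: exec.CondTrue exec.CondFalse elim: exec_CondE)+)

lemma wp_While_True:
  assumes "bval b s" "wp u c s (\<lambda>m s'. wp u (While b c) s' (\<lambda>m'. Q (Suc (m + m'))))"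
  shows "wp u (While b c) s Q"
  using assms unfolding wp_def by (blast intro: exec.WhileTrue)

lemma wp_While_False: "\<not> bval b s \<Longrightarrow> Q 1 s \<Longrightarrow> wp u (While b c) s Q"
  unfolding wp_def by (blast intro: exec.WhileFalse)

text \<open>Each of the \<open>N\<close> rounds costs one test and at most \<open>K\<close> steps,
  and the last failing test costs one more. The induction is on the number of rounds still to
  come.\<close>

lemma wp_While_counted:
  assumes init: "I 0 s"
    and step: "\<And>i s. i < N \<Longrightarrow> I i s \<Longrightarrow> bval b s \<and> wp u c s (\<lambda>m s'. m \<le> K \<and> I (Suc i) s')"
    and final: "\<And>s. I N s \<Longrightarrow> \<not> bval b s"
  shows "wp u (While b c) s (\<lambda>m s'. m \<le> N * Suc K + 1 \<and> I N s')"
proof -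
  have "wp u (While b c) s (\<lambda>m s'. m \<le> d * Suc K + 1 \<and> I N s')"
    if "d \<le> N" "I (N - d) s" for d s
    using that
  proof (induction d arbitrary: s)
    case 0 then show ?case using final by (intro wp_While_False) auto
  next
    case (Suc d)
    then have "N - Suc d < N" "Suc (N - Suc d) = N - d" by auto
    then have b: "bval b s" and c: "wp u c s (\<lambda>m s'. m \<le> K \<and> I (N - d) s')"
      using step[OF _ Suc.prems(2)] by auto
    show ?case
    proof (rule wp_While_True[OF b], rule wp_mono[OF c])
      fix m s' assume 1: "m \<le> K \<and> I (N - d) s'"
      then have "wp u (While b c) s' (\<lambda>m s'. m \<le> d * Suc K + 1 \<and> I N s')"
        using Suc.IH Suc.prems(1) by simp
      then show "wp u (While b c) s' (\<lambda>m' s''. Suc (m + m') \<le> Suc d * Suc K + 1 \<and> I N s'')"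
        using 1 by (auto elim: wp_mono)
    qed
  qed
  from this[of N s] init show ?thesis by simp
qed

text \<open>Termination means a finite derivation of \<open>exec\<close>. Induction over it ends at
  a failing test, which the invariant excludes.\<close>

lemma While_diverges:
  assumes inv: "\<And>s. I s \<Longrightarrow> bval b s \<and> wp u c s (\<lambda>m. I)"
  shows "exec u (While b c) s m s' \<Longrightarrow> \<not> I s"
proof (induction "While b c" s m s' rule: exec.induct)
  case (WhileTrue s m1 s1 m2 s2)
  show ?case
  proof
    assume "I s"
    then have "wp u c s (\<lambda>m. I)" using inv by blast
    then have "I s1" using WhileTrue.hyps(2) exec_deterministic unfolding wp_def by blast
    then show False using WhileTrue.hyps by blast
  qed
qed (use inv in blast)

text \<open>Loops with a fixed number of rounds are unrolled when the program is built, so the index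
  can select the code and appear as a constant. The initial \<open>Skip\<close> accounts for the
  extra step in \<open>wp_steps\<close>.\<close>

fun steps :: "nat \<Rightarrow> (nat \<Rightarrow> com) \<Rightarrow> com" where
  "steps 0 f = Skip"
| "steps (Suc k) f = Seq (steps k f) (f k)"

lemma wp_steps:
  assumes init: "I 0 s"
    and step: "\<And>i s. i < N \<Longrightarrow> I i s \<Longrightarrow> wp u (f i) s (\<lambda>m s'. m \<le> K \<and> I (Suc i) s')"
  shows "wp u (steps N f) s (\<lambda>m s'. m \<le> N * K + 1 \<and> I N s')"
  using step
proof (induction N)
  case 0 then show ?case using init by simp
next
  case (Suc N)
  have "wp u (steps N f) s (\<lambda>m s'. m \<le> N * K + 1 \<and> I N s')" using Suc by simp
  then show ?case
    by simp (rule wp_mono, assumption, rule wp_mono[OF Suc.prems[of N]], auto)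
qed

section \<open>The program\<close>

text \<open>One pass of selection sort: \<open>r\<close> carries the extreme seen so far and is
  finally put into the last cell of the prefix, which \<open>hi\<close> then excludes. Only swaps
  occur, so the data survive as a multiset.\<close>

definition drop_extreme :: "bool \<Rightarrow> com" where
  "drop_extreme mx =
     Seq (NAssign ''hi'' (NSub (NVar ''hi'') (NConst 1)))
    (Seq (RAssign ''r'' (RLoad (NVar ''hi'')))
    (Seq (NAssign ''j'' (NConst 0))
    (Seq (While (NLess (NVar ''j'') (NVar ''hi''))
           (Seq (Cond (if mx then RLess (RVar ''r'') (RLoad (NVar ''j''))
                       else RLess (RLoad (NVar ''j'')) (RVar ''r''))
                  (Seq (RAssign ''tmp'' (RVar ''r''))
                  (Seq (RAssign ''r'' (RLoad (NVar ''j'')))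
                       (RStore (NVar ''j'') (RVar ''tmp''))))
                  Skip)
                (NAssign ''j'' (NAdd (NVar ''j'') (NConst 1)))))
         (RStore (NVar ''hi'') (RVar ''r'')))))"

definition measure_spread :: com where
  "measure_spread =
     Seq (NAssign ''j'' (NConst 0))
    (Seq (RAssign ''sum'' (RConst 0))
    (Seq (RAssign ''sq'' (RConst 0))
    (Seq (While (NLess (NVar ''j'') (NVar ''hi''))
           (Seq (RAssign ''sum'' (RAdd (RVar ''sum'') (RLoad (NVar ''j''))))
           (Seq (RAssign ''sq'' (RAdd (RVar ''sq'') (RMul (RLoad (NVar ''j'')) (RLoad (NVar ''j'')))))
                (NAssign ''j'' (NAdd (NVar ''j'') (NConst 1))))))
         (RAssign ''tmp'' (RSub (RVar ''sq'')
            (RDiv (RMul (RVar ''sum'') (RVar ''sum'')) (ROfNat (NVar ''hi''))))))))"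

text \<open>The exempted registers are the scratch registers of the preparation.\<close>

definition regs_kept :: "state \<Rightarrow> state \<Rightarrow> bool" where
  "regs_kept s s' \<longleftrightarrow>
     (\<forall>v. v \<notin> {''hi'', ''j''} \<longrightarrow> nreg s' v = nreg s v) \<and>
     (\<forall>v. v \<notin> {''r'', ''tmp'', ''sum'', ''sq'', ''best''} \<longrightarrow> rreg s' v = rreg s v) \<and>
     draws s' = draws s"

definition cells :: "state \<Rightarrow> nat \<Rightarrow> real multiset" where
  "cells s k = mset (map (mem s) [0..<k])"

lemma cells_0 [simp]: "cells s 0 = {#}"
  by (simp add: cells_def)

lemma cells_Suc: "cells s (Suc k) = add_mset (mem s k) (cells s k)"
  by (simp add: cells_def)

lemma size_cells [simp]: "size (cells s k) = k"
  by (simp add: cells_def)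

lemma in_cells: "y \<in># cells s k \<longleftrightarrow> (\<exists>i<k. y = mem s i)"
  by (auto simp: cells_def)

lemma cells_cong: "(\<And>i. i < k \<Longrightarrow> mem s i = mem s' i) \<Longrightarrow> cells s k = cells s' k"
  unfolding cells_def by (rule arg_cong[of _ _ mset]) auto

text \<open>Passes work on shrinking prefixes, but the whole vector must survive, up to order, for
  the next pair of deletion counts.\<close>

lemma cells_extend:
  assumes "cells s' h = cells s h" "\<And>i. h \<le> i \<Longrightarrow> mem s' i = mem s i" "h \<le> k"
  shows "cells s' k = cells s k"
  using assms(3) by (induction rule: dec_induct) (simp_all add: assms cells_Suc)

lemma cells_store:
  assumes "i < k" "mem s' = (mem s)(i := y)"
  shows "add_mset (mem s i) (cells s' k) = add_mset y (cells s k)"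
proof -
  have "map (mem s') [0..<k] = (map (mem s) [0..<k])[i := y]"
    using assms by (intro nth_equalityI) auto
  then have "cells s' k = add_mset y (cells s k - {#mem s i#})"
    using assms(1) by (simp add: cells_def mset_update)
  moreover have "mem s i \<in># cells s k" using assms(1) in_cells by blast
  ultimately show ?thesis by (metis add_mset_commute insert_DiffM)
qed

lemma wp_drop_extreme:
  assumes H: "nreg s ''hi'' = H"
  shows "wp u (drop_extreme mx) s (\<lambda>m s'. m \<le> 6 * (H + 1) \<and> regs_kept s s' \<and>
    rreg s' ''best'' = rreg s ''best'' \<and> nreg s' ''hi'' = H - 1 \<and>
    (\<forall>i\<ge>H. mem s' i = mem s i) \<and> cells s' H = cells s H \<and>
    cells s' (H - 1) = (if mx then remove_max else remove_min) (cells s H))"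
proof -
  define h where "h = H - 1"
  \<comment> \<open>\<open>r\<close> together with the first \<open>h\<close> cells always forms the
    original multiset, cell \<open>h\<close> standing in for the hole, and \<open>r\<close> is
    extreme among the cells already visited.\<close>
  define I where "I = (\<lambda>i s'. regs_kept s s' \<and> rreg s' ''best'' = rreg s ''best'' \<and> nreg s' ''hi'' = h \<and> nreg s' ''j'' = i \<and>
     (\<forall>i\<ge>h. mem s' i = mem s i) \<and>
     add_mset (rreg s' ''r'') (cells s' h) = add_mset (mem s h) (cells s h) \<and>
     (\<forall>a<i. if mx then mem s' a \<le> rreg s' ''r'' else rreg s' ''r'' \<le> mem s' a))"
  let ?b = "NLess (NVar ''j'') (NVar ''hi'')"
  let ?c = "Seq (Cond (if mx then RLess (RVar ''r'') (RLoad (NVar ''j''))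
                       else RLess (RLoad (NVar ''j'')) (RVar ''r''))
                  (Seq (RAssign ''tmp'' (RVar ''r''))
                  (Seq (RAssign ''r'' (RLoad (NVar ''j'')))
                       (RStore (NVar ''j'') (RVar ''tmp''))))
                  Skip)
                (NAssign ''j'' (NAdd (NVar ''j'') (NConst 1)))"
  have "wp u (While ?b ?c) s0 (\<lambda>m s'. m \<le> h * Suc 5 + 1 \<and> I h s')" if "I 0 s0" for s0
  proof (rule wp_While_counted)
    show "I 0 s0" by fact
    show "\<not> bval ?b s'" if "I h s'" for s' using that by (simp add: I_def)
    fix i s' assume i: "i < h" and "I i s'"
    then have I: "regs_kept s s'" "rreg s' ''best'' = rreg s ''best''" "nreg s' ''hi'' = h" "nreg s' ''j'' = i"
      "\<And>i. i \<ge> h \<Longrightarrow> mem s' i = mem s i"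
      "add_mset (rreg s' ''r'') (cells s' h) = add_mset (mem s h) (cells s h)"
      "\<And>a. a < i \<Longrightarrow> if mx then mem s' a \<le> rreg s' ''r'' else rreg s' ''r'' \<le> mem s' a"
      by (auto simp: I_def)
    define cond where "cond = (if mx then rreg s' ''r'' < mem s' i else mem s' i < rreg s' ''r'')"
    have keep: "I (Suc i) (s'\<lparr>nreg := (nreg s')(''j'' := Suc i)\<rparr>)" if "\<not> cond"
      using I that by (auto simp: I_def regs_kept_def cells_def cond_def less_Suc_eq split: if_splits)
    have swap: "I (Suc i) (s'\<lparr>rreg := (rreg s')(''tmp'' := rreg s' ''r'', ''r'' := mem s' i),
        mem := (mem s')(i := rreg s' ''r''), nreg := (nreg s')(''j'' := Suc i)\<rparr>)" (is "I _ ?s") if cond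
    proof -
      have "add_mset (mem s' i) (cells ?s h) = add_mset (rreg s' ''r'') (cells s' h)"
        by (rule cells_store) (use i in simp_all)
      moreover have "\<forall>a<Suc i. if mx then mem ?s a \<le> rreg ?s ''r'' else rreg ?s ''r'' \<le> mem ?s a"
      proof (intro allI impI)
        fix a assume "a < Suc i"
        then show "if mx then mem ?s a \<le> rreg ?s ''r'' else rreg ?s ''r'' \<le> mem ?s a"
          using \<open>cond\<close> I(7)[of a] by (auto simp: cond_def less_Suc_eq split: if_splits)
      qed
      ultimately show ?thesis
        using I(1-6) i unfolding I_def by (intro conjI) (simp_all add: regs_kept_def)
    qed
    show "bval ?b s' \<and> wp u ?c s' (\<lambda>m s'. m \<le> 5 \<and> I (Suc i) s')"
      using i I(3,4) keep swap by (cases mx; cases cond) (simp_all add: cond_def)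
  qed
  then have loop: "wp u (While ?b ?c) s0 (\<lambda>m s'. m \<le> 6 * h + 1 \<and> I h s')" if "I 0 s0" for s0
    by (rule wp_mono[OF _]) (use that in simp_all)
  have post: "regs_kept s s'' \<and> rreg s'' ''best'' = rreg s ''best'' \<and> nreg s'' ''hi'' = h \<and> (\<forall>i\<ge>H. mem s'' i = mem s i) \<and>
      cells s'' H = cells s H \<and> cells s'' h = (if mx then remove_max else remove_min) (cells s H)"
    if I: "I h s'" and s'': "s'' = s'\<lparr>mem := (mem s')(nreg s' ''hi'' := rreg s' ''r'')\<rparr>" for s' s''
  proof -
    have rest: "regs_kept s s''" "rreg s'' ''best'' = rreg s ''best''" "nreg s'' ''hi'' = h"
      using I by (simp_all add: I_def s'' regs_kept_def)
    have same: "cells s'' h = cells s' h" by (rule cells_cong) (use I in \<open>simp add: s'' I_def\<close>)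
    show ?thesis
    proof (cases H)
      \<comment> \<open>On an empty prefix truncated subtraction leaves \<open>hi\<close> at 0, and
        the final store writes back the content just read from cell 0. So datasets with fewer
        entries than deletions are harmless.\<close>
      case 0
      then show ?thesis using I rest by (auto simp: I_def s'' h_def)
    next
      case (Suc h')
      then have H: "H = Suc h" by (simp add: h_def)
      let ?r = "rreg s' ''r''"
      have cs: "cells s H = add_mset ?r (cells s' h)" using I by (simp add: I_def H cells_Suc)
      have r: "if mx then y \<le> ?r else ?r \<le> y" if "y \<in># cells s H" for y
        using that I unfolding cs by (auto simp: I_def in_cells)
      have "mx \<Longrightarrow> remove_max (cells s H) = cells s H - {#?r#}"
        by (rule remove_max_eq) (use r in \<open>simp_all add: cs\<close>)
      moreover have "\<not> mx \<Longrightarrow> remove_min (cells s H) = cells s H - {#?r#}"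
        by (rule remove_min_eq) (use r in \<open>simp_all add: cs\<close>)
      moreover have "cells s H - {#?r#} = cells s' h" by (simp add: cs)
      moreover have "cells s'' H = cells s H"
        using I same by (simp add: H cells_Suc I_def s'')
      ultimately show ?thesis using I rest same by (auto simp: I_def s'' cs H)
    qed
  qed
  show ?thesis
    unfolding drop_extreme_def wp_Seq wp_NAssign wp_RAssign wp_RStore
  proof (rule wp_mono[OF loop], goal_cases)
    case 1
    show ?case using H by (simp add: I_def h_def regs_kept_def cells_def)
  next
    case (2 m s')
    then show ?case using post[of s'] by (auto simp: h_def)
  qed
qed

lemma wp_measure_spread:
  assumes H: "nreg s ''hi'' = H"
  shows "wp u measure_spread s (\<lambda>m s'. m \<le> 6 * (H + 1) \<and> regs_kept s s' \<and>
    mem s' = mem s \<and> rreg s' ''best'' = rreg s ''best'' \<and> rreg s' ''tmp'' = ssd (cells s H))"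
proof -
  define I where "I = (\<lambda>i s'. regs_kept s s' \<and> nreg s' ''hi'' = H \<and> nreg s' ''j'' = i \<and>
     mem s' = mem s \<and> rreg s' ''best'' = rreg s ''best'' \<and>
     rreg s' ''sum'' = (\<Sum>y\<in>#cells s i. y) \<and> rreg s' ''sq'' = (\<Sum>y\<in>#cells s i. y\<^sup>2))"
  let ?b = "NLess (NVar ''j'') (NVar ''hi'')"
  let ?c = "Seq (RAssign ''sum'' (RAdd (RVar ''sum'') (RLoad (NVar ''j''))))
           (Seq (RAssign ''sq'' (RAdd (RVar ''sq'') (RMul (RLoad (NVar ''j'')) (RLoad (NVar ''j'')))))
                (NAssign ''j'' (NAdd (NVar ''j'') (NConst 1))))"
  have "wp u (While ?b ?c) s0 (\<lambda>m s'. m \<le> H * Suc 3 + 1 \<and> I H s')" if "I 0 s0" for s0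
  proof (rule wp_While_counted)
    show "I 0 s0" by fact
    show "\<not> bval ?b s'" if "I H s'" for s' using that by (simp add: I_def)
    show "bval ?b s' \<and> wp u ?c s' (\<lambda>m s'. m \<le> 3 \<and> I (Suc i) s')" if "i < H" "I i s'" for i s'
      using that by (simp add: I_def regs_kept_def cells_Suc power2_eq_square)
  qed
  then have loop: "wp u (While ?b ?c) s0 (\<lambda>m s'. m \<le> 4 * H + 1 \<and> I H s')" if "I 0 s0" for s0
    by (rule wp_mono[OF _ ]) (use that in simp_all)
  show ?thesis
    unfolding measure_spread_def
    by (simp del: One_nat_def, rule wp_mono[OF loop])
      (use H in \<open>auto simp: I_def regs_kept_def ssd_def power2_eq_square\<close>)
qed

definition trimmed_spread :: "nat \<Rightarrow> nat \<Rightarrow> com" where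
  "trimmed_spread i j =
     Seq (NAssign ''hi'' (NVar ''n''))
    (Seq (steps i (\<lambda>_. drop_extreme False))
    (Seq (steps j (\<lambda>_. drop_extreme True)) measure_spread))"

lemma regs_kept_refl: "regs_kept s s"
  by (simp add: regs_kept_def)

lemma regs_kept_trans: "regs_kept s s' \<Longrightarrow> regs_kept s' s'' \<Longrightarrow> regs_kept s s''"
  by (simp add: regs_kept_def)

text \<open>The data may be permuted, but the cells from \<open>N\<close> on hold the table of lower
  bounds computed so far and must stay exactly as they are.\<close>

definition data_kept :: "nat \<Rightarrow> state \<Rightarrow> state \<Rightarrow> bool" where
  "data_kept N s s' \<longleftrightarrow> regs_kept s s' \<and> cells s' N = cells s N \<and> (\<forall>i\<ge>N. mem s' i = mem s i)"

lemma data_kept_trans: "data_kept N s s' \<Longrightarrow> data_kept N s' s'' \<Longrightarrow> data_kept N s s''"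
  by (auto simp: data_kept_def intro: regs_kept_trans)

lemma wp_drop_extremes:
  assumes "nreg s ''hi'' \<le> N"
  shows "wp u (steps k (\<lambda>_. drop_extreme mx)) s (\<lambda>m s'. m \<le> k * (6 * (N + 1)) + 1 \<and>
    data_kept N s s' \<and> rreg s' ''best'' = rreg s ''best'' \<and> nreg s' ''hi'' \<le> N \<and>
    cells s' (nreg s' ''hi'') =
      ((if mx then remove_max else remove_min) ^^ k) (cells s (nreg s ''hi'')))"
proof -
  define I where "I = (\<lambda>k s'. data_kept N s s' \<and> rreg s' ''best'' = rreg s ''best'' \<and>
    nreg s' ''hi'' \<le> N \<and> cells s' (nreg s' ''hi'') =
      ((if mx then remove_max else remove_min) ^^ k) (cells s (nreg s ''hi'')))"
  have "wp u (steps k (\<lambda>_. drop_extreme mx)) s (\<lambda>m s'. m \<le> k * (6 * (N + 1)) + 1 \<and> I k s')"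
  proof (rule wp_steps)
    show "I 0 s" using assms by (simp add: I_def data_kept_def regs_kept_refl)
    fix i s1 assume I: "I i s1"
    define H where "H = nreg s1 ''hi''"
    show "wp u (drop_extreme mx) s1 (\<lambda>m s'. m \<le> 6 * (N + 1) \<and> I (Suc i) s')"
    proof (rule wp_mono[OF wp_drop_extreme[of s1 H]], goal_cases)
      case (2 m s')
      have "H \<le> N" using I by (simp add: I_def H_def)
      moreover have "cells s' N = cells s1 N"
        by (rule cells_extend[of _ H]) (use 2 \<open>H \<le> N\<close> in auto)
      ultimately have "data_kept N s1 s'" using 2 by (simp add: data_kept_def)
      then show ?case using 2 I \<open>H \<le> N\<close>
        by (auto simp: I_def H_def intro: data_kept_trans)
    qed (simp add: H_def)
  qed
  then show ?thesis by (simp add: I_def)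
qed

lemma wp_trimmed_spread:
  assumes "nreg s ''n'' = N" "i + j \<le> 100"
  shows "wp u (trimmed_spread i j) s (\<lambda>m s'. m \<le> 700 * (N + 1) \<and>
    data_kept N s s' \<and> rreg s' ''best'' = rreg s ''best'' \<and>
    rreg s' ''tmp'' = ssd (trim i j (cells s N)))"
proof -
  let ?s = "s\<lparr>nreg := (nreg s)(''hi'' := N)\<rparr>"
  have 1: "data_kept N s ?s" by (simp add: data_kept_def regs_kept_def cells_def)
  have c: "cells ?s N = cells s N" by (simp add: cells_def)
  \<comment> \<open>At most 100 deletion passes of 6 (N + 1) steps give 600 (N + 1); the bound 700
    (N + 1) leaves room for the measuring pass and the overhead.\<close>
  have "i * (6 * (N + 1)) + j * (6 * (N + 1)) \<le> 600 * (N + 1)"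
    using mult_le_mono1[OF assms(2), of "6 * (N + 1)"] by (simp add: add_mult_distrib)
  then have time: "Suc (m1 + (m2 + m3)) \<le> 700 * (N + 1)"
    if "m1 \<le> i * (6 * (N + 1)) + 1" "m2 \<le> j * (6 * (N + 1)) + 1" "m3 \<le> 6 * (h + 1)" "h \<le> N"
    for m1 m2 m3 h
    using that by simp
  show ?thesis
    unfolding trimmed_spread_def
  proof (simp add: assms(1), rule wp_mono[OF wp_drop_extremes[of ?s N]], goal_cases)
    case (2 m1 s1)
    show ?case
    proof (rule wp_mono[OF wp_drop_extremes[of s1 N]], goal_cases)
      case 1 show ?case using 2 by simp
    next
      case 3: (2 m2 s2)
      show ?case
      proof (rule wp_mono[OF wp_measure_spread[OF refl]], goal_cases)
        case 4: (1 m3 s3)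
        have "data_kept N s2 s3" using 4 by (simp add: data_kept_def cells_def)
        then have "data_kept N s s3" using 1 2 3 by (meson data_kept_trans)
        moreover have "rreg s3 ''tmp'' = ssd (trim i j (cells s N))"
          using 2 3 4 c by (simp add: trim_def)
        moreover have "Suc (m1 + (m2 + m3)) \<le> 700 * (N + 1)"
          by (rule time) (use 2 3 4 in auto)
        ultimately show ?case using 2 3 4 by simp
      qed
    qed
  qed simp
qed

text \<open>The candidate with all deletions at the bottom initialises \<open>best\<close>, so no
  infinite start value is required; the unrolled loop moves one deletion after another to the
  top.\<close>

definition lower_bound :: "nat \<Rightarrow> com" where
  "lower_bound l =
     Seq (trimmed_spread l 0)
    (Seq (RAssign ''best'' (RVar ''tmp''))
    (Seq (steps l (\<lambda>j. Seq (trimmed_spread (l - Suc j) (Suc j))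
           (Cond (RLess (RVar ''tmp'') (RVar ''best'')) (RAssign ''best'' (RVar ''tmp'')) Skip)))
         (RStore (NAdd (NVar ''n'') (NConst l)) (RDiv (RVar ''best'') (ROfNat (NVar ''n''))))))"

lemma wp_lower_bound:
  assumes n: "nreg s ''n'' = N" and l: "l \<le> 100"
  shows "wp u (lower_bound l) s (\<lambda>m s'. m \<le> 71000 * (N + 1) \<and> regs_kept s s' \<and>
    cells s' N = cells s N \<and> mem s' (N + l) = min_ssd (cells s N) l / real N \<and>
    (\<forall>i\<ge>N. i \<noteq> N + l \<longrightarrow> mem s' i = mem s i))"
proof -
  let ?M = "cells s N"
  define best where "best = (\<lambda>j. MIN j\<in>{..j}. ssd (trim (l - j) j ?M))"
  have best: "best 0 = ssd (trim l 0 ?M)"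
    "best (Suc j) = min (ssd (trim (l - Suc j) (Suc j) ?M)) (best j)" "best l = min_ssd ?M l" for j
    by (simp_all add: best_def atMost_Suc min_ssd_eq_Min)
  let ?c = "\<lambda>j. Seq (trimmed_spread (l - Suc j) (Suc j))
           (Cond (RLess (RVar ''tmp'') (RVar ''best'')) (RAssign ''best'' (RVar ''tmp'')) Skip)"
  define I where "I = (\<lambda>j s'. data_kept N s s' \<and> rreg s' ''best'' = best j)"
  have loop: "wp u (steps l ?c) s1 (\<lambda>m s'. m \<le> l * (700 * (N + 1) + 2) + 1 \<and> I l s')"
    if "I 0 s1" for s1
  proof (rule wp_steps)
    show "I 0 s1" by fact
    fix j s1 assume j: "j < l" and I: "I j s1"
    have n1: "nreg s1 ''n'' = N" "cells s1 N = ?M"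
      using I n by (simp_all add: I_def data_kept_def regs_kept_def)
    have "data_kept N s (s'\<lparr>rreg := (rreg s')(''best'' := y)\<rparr>)"
      if "data_kept N s1 s'" for s' y
    proof -
      have "data_kept N s' (s'\<lparr>rreg := (rreg s')(''best'' := y)\<rparr>)"
        by (simp add: data_kept_def regs_kept_def cells_def)
      then show ?thesis using I that by (auto simp: I_def intro: data_kept_trans)
    qed
    moreover have "data_kept N s s'" if "data_kept N s1 s'" for s'
      using I that by (auto simp: I_def intro: data_kept_trans)
    ultimately show "wp u (?c j) s1 (\<lambda>m s'. m \<le> 700 * (N + 1) + 2 \<and> I (Suc j) s')"
      using I j l n1 by (simp, intro wp_mono[OF wp_trimmed_spread[OF n1(1)]]) (auto simp: I_def best(2) min_def)
  qed
  have "l * (700 * (N + 1) + 2) \<le> 100 * (700 * (N + 1) + 2)"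
    using l by (rule mult_le_mono1)
  then have time: "m1 + Suc (Suc m2) \<le> 71000 * (N + 1)"
    if "m1 \<le> 700 * (N + 1)" "m2 \<le> l * (700 * (N + 1) + 2) + 1" for m1 m2
    using that by simp
  show ?thesis
    unfolding lower_bound_def
  proof (simp, rule wp_mono[OF wp_trimmed_spread[OF n]], goal_cases)
    case 1 show ?case using l by simp
  next
    case (2 m1 s1)
    let ?s = "s1\<lparr>rreg := (rreg s1)(''best'' := rreg s1 ''tmp'')\<rparr>"
    have "data_kept N s1 ?s" by (simp add: data_kept_def regs_kept_def cells_def)
    with 2 have "data_kept N s ?s" by (blast intro: data_kept_trans)
    then have "I 0 ?s" using 2 by (simp add: I_def best(1))
    then show ?case
    proof (rule wp_mono[OF loop], goal_cases)
      case 3: (1 m2 s2)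
      then have n2: "nreg s2 ''n'' = N" using n by (simp add: I_def data_kept_def regs_kept_def)
      have "cells (s2\<lparr>mem := (mem s2)(N + l := y)\<rparr>) N = cells s2 N" for y
        by (rule cells_cong) simp
      then show ?case
        using 2 3 time[of m1 m2] n2 by (auto simp: I_def data_kept_def regs_kept_def best(3))
    qed
  qed
qed

text \<open>From here on the data entries enter only through the table of 101 lower bounds, whose
  entry 0 is the variance. This is why a query takes constant time.\<close>

definition ready :: "domain \<Rightarrow> real \<Rightarrow> real \<Rightarrow> real \<Rightarrow> real list \<Rightarrow> nat \<Rightarrow> state \<Rightarrow> bool" where
  "ready D \<beta> eps1 eps2 x d s \<longleftrightarrow>
     nreg s ''n'' = length x \<and> nreg s ''go'' = 0 \<and> draws s = d \<and>
     rreg s ''beta'' = \<beta> \<and> rreg s ''eps1'' = eps1 \<and> rreg s ''eps2'' = eps2 \<and>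
     (case D of
        Interval a b \<Rightarrow> rreg s ''bounded'' = 1 \<and> rreg s ''a'' = a \<and> rreg s ''b'' = b
      | RealLine \<Rightarrow> rreg s ''bounded'' = 0) \<and>
     (\<forall>l\<le>100. mem s (length x + l) = L_var l x)"

lemma wp_lower_bounds:
  assumes "x \<noteq> []"
  shows "wp u (steps 101 lower_bound) (initial_state D \<beta> eps1 eps2 x)
    (\<lambda>m s. m \<le> 7180000 * (length x + 1) \<and> ready D \<beta> eps1 eps2 x 0 s)"
proof -
  let ?N = "length x" and ?s0 = "initial_state D \<beta> eps1 eps2 x"
  define I where "I = (\<lambda>l s. regs_kept ?s0 s \<and> cells s ?N = mset x \<and>
    (\<forall>i<l. mem s (?N + i) = L_var i x))"
  have "wp u (steps 101 lower_bound) ?s0 (\<lambda>m s. m \<le> 101 * (71000 * (?N + 1)) + 1 \<and> I 101 s)"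
  proof (rule wp_steps)
    have "map (mem ?s0) [0..<?N] = x" by (intro nth_equalityI) (simp_all add: initial_state_def)
    then have "cells ?s0 ?N = mset x" by (simp only: cells_def)
    then show "I 0 ?s0" by (simp add: I_def regs_kept_refl)
    fix l s assume l: "l < 101" and I: "I l s"
    have n: "nreg s ''n'' = ?N" using I by (simp add: I_def regs_kept_def initial_state_def)
    show "wp u (lower_bound l) s (\<lambda>m s'. m \<le> 71000 * (?N + 1) \<and> I (Suc l) s')"
    proof (rule wp_mono[OF wp_lower_bound[OF n]], goal_cases)
      case 1 show ?case using l by simp
    next
      case (2 m s')
      then have "mem s' (?N + i) = L_var i x" if "i < Suc l" for i
        using I that assms by (cases "i = l") (auto simp: I_def L_var_attained(1))
      then show ?case using 2 I by (auto simp: I_def intro: regs_kept_trans)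
    qed
  qed
  then show ?thesis
  proof (rule wp_mono, goal_cases)
    case (1 m s)
    then show ?case
      by (cases D) (auto simp: I_def ready_def regs_kept_def initial_state_def)
  qed
qed

text \<open>The three branches match t below, above and at the variance, read from entry 0 of the
  table. \<open>len\<close> advances to l + 1 only while it equals \<open>l\<close>, so it freezes
  at the first admissible level or ends at 101. The ceiling is obtained as the negated floor of the
  negated quotient.\<close>

definition query_value :: com where
  "query_value =
     Cond (RLess (RVar ''t'') (RLoad (NVar ''n'')))
       (Seq (NAssign ''len'' (NConst 0))
       (Seq (steps 101 (\<lambda>l. Cond (BAnd (BNot (NLess (NVar ''len'') (NConst l)))
                                   (RLess (RVar ''t'') (RLoad (NAdd (NVar ''n'') (NConst l)))))
                         (NAssign ''len'' (NConst (Suc l))) Skip))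
            (RAssign ''q'' (RSub (RDiv (RConst 1) (RConst 2)) (ROfNat (NVar ''len''))))))
       (Cond (RLess (RLoad (NVar ''n'')) (RVar ''t''))
         (Cond (RLess (RConst 0) (RVar ''bounded''))
           (Seq (RAssign ''w'' (RSub (RVar ''b'') (RVar ''a'')))
                (RAssign ''q'' (RSub (RSub (RConst 0) (RFloor (RSub (RConst 0)
                   (RDiv (RMul (ROfNat (NVar ''n'')) (RSub (RVar ''t'') (RLoad (NVar ''n''))))
                         (RMul (RVar ''w'') (RVar ''w''))))))
                   (RDiv (RConst 1) (RConst 2)))))
           (RAssign ''q'' (RDiv (RConst 1) (RConst 2))))
         (RAssign ''q'' (RConst 0)))"

definition query :: com where
  "query =
     Seq (RAssign ''t'' (RSub (RVar ''pow'') (RConst 1)))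
    (Seq query_value
    (Seq (Draw ''nu'' (RDiv (RConst 1) (RVar ''eps2'')))
         (Cond (RLess (RAdd (RVar ''q'') (RVar ''nu'')) (RVar ''z''))
           (RAssign ''pow'' (RMul (RVar ''pow'') (RVar ''beta'')))
           (Seq (NAssign ''go'' (NConst 1)) (RAssign ''out'' (RVar ''t''))))))"

definition preparation :: com where
  "preparation =
     Seq (steps 101 lower_bound)
    (Seq (Draw ''z'' (RDiv (RConst 1) (RVar ''eps1'')))
         (RAssign ''pow'' (RVar ''beta'')))"

definition program :: com where
  "program = Seq preparation (While (NLess (NVar ''go'') (NConst 1)) query)"

text \<open>The index k is both the number of the next query and the number of variates consumed:
  \<open>u 0\<close> went into \<open>Z\<close> and the earlier queries used \<open>u 1\<close> up
  to \<open>u (k - 1)\<close>, in agreement with \<open>noise_of\<close>.\<close>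

definition loop_inv :: "domain \<Rightarrow> real \<Rightarrow> real \<Rightarrow> real \<Rightarrow> real list \<Rightarrow> (nat \<Rightarrow> real) \<Rightarrow> nat \<Rightarrow> state \<Rightarrow> bool"
  where "loop_inv D \<beta> eps1 eps2 x u k s \<longleftrightarrow> ready D \<beta> eps1 eps2 x k s \<and>
     rreg s ''z'' = 1 / eps1 * u 0 \<and> rreg s ''pow'' = \<beta> ^ k"

lemma wp_query_length:
  assumes N: "nreg s ''n'' = N" and t: "rreg s ''t'' = t" and len: "nreg s ''len'' = 0"
    and c: "\<And>l. l \<le> 100 \<Longrightarrow> mem s (N + l) = L l"
  shows "wp u (steps 101 (\<lambda>l. Cond (BAnd (BNot (NLess (NVar ''len'') (NConst l)))
                                   (RLess (RVar ''t'') (RLoad (NAdd (NVar ''n'') (NConst l)))))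
                             (NAssign ''len'' (NConst (Suc l))) Skip)) s
    (\<lambda>m s'. m \<le> 203 \<and> (\<exists>l\<le>101. s' = s\<lparr>nreg := (nreg s)(''len'' := l)\<rparr> \<and>
       (\<forall>j<l. t < L j) \<and> (l \<le> 100 \<longrightarrow> L l \<le> t)))"
    (is "wp u (steps _ ?c) _ _")
proof -
  \<comment> \<open>A length \<open>l\<close> below the counter \<open>i\<close> is final, whereas
    \<open>l = i\<close> means that no admissible level has been seen yet.\<close>
  define I where "I = (\<lambda>i s'. \<exists>l\<le>i. s' = s\<lparr>nreg := (nreg s)(''len'' := l)\<rparr> \<and>
     (\<forall>j<l. t < L j) \<and> (l < i \<longrightarrow> L l \<le> t))"
  have "wp u (steps 101 ?c) s (\<lambda>m s'. m \<le> 101 * 2 + 1 \<and> I 101 s')"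
  proof (rule wp_steps)
    have "s\<lparr>nreg := (nreg s)(''len'' := 0)\<rparr> = s" using len by (simp add: fun_upd_idem)
    then show "I 0 s" by (simp add: I_def)
    fix i s' assume i: "i < 101" and "I i s'"
    then obtain l where l: "l \<le> i" "s' = s\<lparr>nreg := (nreg s)(''len'' := l)\<rparr>"
      "\<forall>j<l. t < L j" "l < i \<longrightarrow> L l \<le> t" by (auto simp: I_def)
    have keep: "I (Suc i) s'" if "l < i \<or> \<not> t < L i"
      unfolding I_def by (rule exI[of _ l]) (use l that in \<open>auto simp: less_Suc_eq\<close>)
    have incr: "I (Suc i) (s'\<lparr>nreg := (nreg s')(''len'' := Suc i)\<rparr>)" if "\<not> l < i" "t < L i"
      unfolding I_def by (rule exI[of _ "Suc i"]) (use l that in \<open>auto simp: less_Suc_eq\<close>)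
    show "wp u (?c i) s' (\<lambda>m s'. m \<le> 2 \<and> I (Suc i) s')"
      using keep incr l(2) N t c[of i] i by auto
  qed
  then show ?thesis by (rule wp_mono) (auto simp: I_def less_Suc_eq_le)
qed

lemma wp_query_value:
  assumes x: "x \<noteq> []" and D: "valid_domain D" and t: "0 \<le> t" "rreg s ''t'' = t"
    and inv: "loop_inv D \<beta> eps1 eps2 x u k s"
  shows "wp u query_value s (\<lambda>m s'. m \<le> 210 \<and> loop_inv D \<beta> eps1 eps2 x u k s' \<and>
    rreg s' ''t'' = t \<and> rho_bar D x t = ereal (rreg s' ''q''))"
proof -
  have mem: "mem s (length x + l) = L_var l x" if "l \<le> 100" for l
    using inv that by (simp add: loop_inv_def ready_def)
  have V: "mem s (length x) = vec_var x" using mem[of 0] x by (simp add: L_var_0)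
  have n: "nreg s ''n'' = length x" using inv by (simp add: loop_inv_def ready_def)
  consider "t < vec_var x" | "vec_var x < t" | "t = vec_var x" by linarith
  then show ?thesis
  proof cases
    case 1
    show ?thesis
    proof (simp add: query_value_def n V t(2) 1,
        rule wp_mono[OF wp_query_length[of _ "length x" t "\<lambda>l. L_var l x"]], goal_cases)
      case (5 m s')
      then obtain l where l: "l \<le> 101" "s' = s\<lparr>nreg := (nreg s)(''len'' := l)\<rparr>"
        "\<forall>j<l. t < L_var j x" "l \<le> 100 \<longrightarrow> L_var l x \<le> t" by auto
      then have "rho_bar D x t = ereal (1 / 2 - real l)"
        using rho_bar_below[OF x t(1) 1, of l] by simp
      then show ?case using 5 l(2) inv t(2) by (cases D) (simp_all add: loop_inv_def ready_def)
    qed (simp_all add: n t(2) mem)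
  next
    case 2
    show ?thesis
    proof (cases D)
      case (Interval a b)
      then show ?thesis
        using 2 inv n V t(2) D rho_bar_above_Interval[OF x 2, of a b]
        by (simp add: query_value_def loop_inv_def ready_def ceiling_def power2_eq_square)
    next
      case RealLine
      then show ?thesis
        using 2 inv n V t(2) rho_bar_above_RealLine[OF x 2]
        by (simp add: query_value_def loop_inv_def ready_def)
    qed
  next
    case 3
    then show ?thesis
      using inv n V t(2) rho_bar_at[of D x]
      by (cases D) (simp_all add: query_value_def loop_inv_def ready_def zero_ereal_def)
  qed
qed

lemma wp_query:
  assumes x: "x \<noteq> []" and D: "valid_domain D" and \<beta>: "\<beta> > 1"
    and inv: "loop_inv D \<beta> eps1 eps2 x u k s"
  shows "wp u query s (\<lambda>m s'. m \<le> 300 \<and>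
    (if rho_bar D x (\<beta> ^ k - 1) + ereal (1 / eps2 * u k) < ereal (1 / eps1 * u 0)
     then loop_inv D \<beta> eps1 eps2 x u (Suc k) s'
     else nreg s' ''go'' = 1 \<and> rreg s' ''out'' = \<beta> ^ k - 1))"
proof -
  define t where "t = \<beta> ^ k - 1"
  \<comment> \<open>Nonnegativity makes the lower bound 0 beyond level 100 admissible, so the length
    is finite even if the table contains no admissible level.\<close>
  have t: "0 \<le> t" using \<beta> by (simp add: t_def)
  let ?s = "s\<lparr>rreg := (rreg s)(''t'' := t)\<rparr>"
  have "loop_inv D \<beta> eps1 eps2 x u k ?s"
    using inv by (cases D) (simp_all add: loop_inv_def ready_def)
  note val = wp_query_value[OF x D t _ this]
  have s: "rreg s ''pow'' - 1 = t" using inv by (simp add: loop_inv_def t_def)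
  show ?thesis
    unfolding query_def t_def[symmetric]
  proof (simp add: s, rule wp_mono[OF val], goal_cases)
    case (2 m s')
    then show ?case by (cases D) (auto simp: loop_inv_def ready_def mult.commute)
  qed simp
qed

lemma wp_preparation:
  assumes x: "x \<noteq> []"
  shows "wp u preparation (initial_state D \<beta> eps1 eps2 x)
    (\<lambda>m s. m \<le> 7180000 * (length x + 1) + 2 \<and> loop_inv D \<beta> eps1 eps2 x u 1 s)"
  unfolding preparation_def
proof (simp del: One_nat_def, rule wp_mono[OF wp_lower_bounds[OF x]], goal_cases)
  case (1 m s)
  then show ?case by (cases D) (simp_all add: loop_inv_def ready_def)
qed

section \<open>Runs of the whole program\<close>

definition below :: "domain \<Rightarrow> real \<Rightarrow> real \<Rightarrow> real \<Rightarrow> real list \<Rightarrow> (nat \<Rightarrow> real) \<Rightarrow> nat \<Rightarrow> bool" where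
  "below D \<beta> eps1 eps2 x u k \<longleftrightarrow>
     rho_bar D x (\<beta> ^ k - 1) + ereal (1 / eps2 * u k) < ereal (1 / eps1 * u 0)"

lemma num_queries_noise_of:
  "num_queries D \<beta> x (noise_of eps1 eps2 u) = Some q \<longleftrightarrow>
     1 \<le> q \<and> \<not> below D \<beta> eps1 eps2 x u q \<and> (\<forall>i\<in>{1..<q}. below D \<beta> eps1 eps2 x u i)"
  "num_queries D \<beta> x (noise_of eps1 eps2 u) = None \<longleftrightarrow> (\<forall>i\<ge>1. below D \<beta> eps1 eps2 x u i)"
  unfolding num_queries_def noise_of_def above_threshold_eq_Some above_threshold_eq_None below_def
  by (auto simp: not_less)

text \<open>The preparation takes at most 7180000 (n + 1) + 2 steps, where n + 1 is at most 2 n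
  because n is positive; the loop takes at most 301 q + 1 steps. The constant is twice 7180000 plus
  400 for the loop and the remainders.\<close>

lemma program_returns:
  assumes x: "x \<in> datasets D n" "n \<ge> 1" and D: "valid_domain D" and \<beta>: "\<beta> > 1"
    and q: "num_queries D \<beta> x (noise_of eps1 eps2 u) = Some q"
  shows "\<exists>m. returns program D \<beta> eps1 eps2 x u m (\<beta> ^ q - 1) \<and> m \<le> 14360400 * (n + q)"
proof -
  have n: "length x = n" "x \<noteq> []" using x by (auto simp: datasets_def)
  \<comment> \<open>j counts completed rounds, so round j asks query j + 1; after q rounds the flag
    \<open>go\<close> is set and the output is stored.\<close>
  define I where "I = (\<lambda>j s. if j < q then loop_inv D \<beta> eps1 eps2 x u (Suc j) s
    else nreg s ''go'' = 1 \<and> rreg s ''out'' = \<beta> ^ q - 1)"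
  let ?b = "NLess (NVar ''go'') (NConst 1)"
  have q: "1 \<le> q" "\<not> below D \<beta> eps1 eps2 x u q" "\<And>i. 1 \<le> i \<Longrightarrow> i < q \<Longrightarrow> below D \<beta> eps1 eps2 x u i"
    using q by (simp_all add: num_queries_noise_of)
  have loop: "wp u (While ?b query) s (\<lambda>m s'. m \<le> q * Suc 300 + 1 \<and> I q s')"
    if "loop_inv D \<beta> eps1 eps2 x u 1 s" for s
  proof (rule wp_While_counted)
    show "I 0 s" using that q(1) by (simp add: I_def)
    show "\<not> bval ?b s'" if "I q s'" for s' using that by (simp add: I_def)
    fix j s' assume j: "j < q" and "I j s'"
    then have inv: "loop_inv D \<beta> eps1 eps2 x u (Suc j) s'" by (simp add: I_def)
    then have "bval ?b s'" by (simp add: loop_inv_def ready_def)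
    moreover have "wp u query s' (\<lambda>m s'. m \<le> 300 \<and> I (Suc j) s')"
    proof (rule wp_mono[OF wp_query[OF n(2) D \<beta> inv]], unfold below_def[symmetric], goal_cases)
      case (1 m s'')
      show ?case
      proof (cases "Suc j < q")
        case True
        then show ?thesis using 1 q(3)[of "Suc j"] by (simp add: I_def)
      next
        case False
        then have "q = Suc j" using j by simp
        then show ?thesis using 1 q(2) by (simp add: I_def)
      qed
    qed
    ultimately show "bval ?b s' \<and> wp u query s' (\<lambda>m s'. m \<le> 300 \<and> I (Suc j) s')" by simp
  qed
  have "wp u program (initial_state D \<beta> eps1 eps2 x)
      (\<lambda>m s. m \<le> 14360400 * (n + q) \<and> rreg s ''out'' = \<beta> ^ q - 1)"
    unfolding program_def wp_Seq
  proof (rule wp_mono[OF wp_preparation[OF n(2)]], goal_cases)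
    case (1 m s)
    show ?case
      by (rule wp_mono[OF loop]) (use 1 n x(2) in \<open>auto simp: I_def\<close>)
  qed
  then show ?thesis unfolding wp_def returns_def by blast
qed

text \<open>If every answer is below the threshold, each round re-establishes
  \<open>loop_inv\<close> with the next index, and this keeps the guard true.\<close>

lemma program_diverges:
  assumes x: "x \<in> datasets D n" "n \<ge> 1" and D: "valid_domain D" and \<beta>: "\<beta> > 1"
    and none: "num_queries D \<beta> x (noise_of eps1 eps2 u) = None"
  shows "\<not> returns program D \<beta> eps1 eps2 x u m y"
proof
  have n: "x \<noteq> []" using x by (auto simp: datasets_def)
  let ?W = "While (NLess (NVar ''go'') (NConst 1)) query"
  let ?s0 = "initial_state D \<beta> eps1 eps2 x"
  assume "returns program D \<beta> eps1 eps2 x u m y"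
  then have "wp u program ?s0 (\<lambda>_ _. True)" by (auto simp: returns_def wp_def)
  then have "wp u preparation ?s0 (\<lambda>_ s. wp u ?W s (\<lambda>_ _. True))" by (simp add: program_def)
  from wp_conj[OF this wp_preparation[OF n]]
  obtain s m' s' where s: "loop_inv D \<beta> eps1 eps2 x u 1 s" "exec u ?W s m' s'"
    unfolding wp_def by blast
  have "\<not> (\<exists>k\<ge>1. loop_inv D \<beta> eps1 eps2 x u k s)"
  proof (rule While_diverges[OF _ s(2)])
    fix s assume "\<exists>k\<ge>1. loop_inv D \<beta> eps1 eps2 x u k s"
    then obtain k where k: "k \<ge> 1" "loop_inv D \<beta> eps1 eps2 x u k s" by blast
    then have "below D \<beta> eps1 eps2 x u k" using none by (simp add: num_queries_noise_of)
    then have "wp u query s (\<lambda>m s. \<exists>k\<ge>1. loop_inv D \<beta> eps1 eps2 x u k s)"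
      by (intro wp_mono[OF wp_query[OF n D \<beta> k(2)]], unfold below_def[symmetric])
        (auto intro!: exI[of _ "Suc k"])
    then show "bval (NLess (NVar ''go'') (NConst 1)) s \<and>
        wp u query s (\<lambda>m s. \<exists>k\<ge>1. loop_inv D \<beta> eps1 eps2 x u k s)"
      using k by (simp add: loop_inv_def ready_def)
  qed
  with s(1) show False by blast
qed

theorem theorem5p5:
  shows "(\<forall>D n \<beta> eps1 eps2.
            valid_domain D \<and> n \<ge> 1 \<and> \<beta> > 1 \<and> eps1 > 0 \<and> eps2 > 0 \<longrightarrow>
            differentially_private (datasets D n) output_space (eps1 + 2 * eps2)
              (var_mechanism D \<beta> eps1 eps2))
       \<and> (\<exists>p. \<exists>C::nat. \<forall>D n \<beta> eps1 eps2.
            valid_domain D \<and> n \<ge> 1 \<and> \<beta> > 1 \<and> eps1 > 0 \<and> eps2 > 0 \<longrightarrow>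
            (\<forall>x\<in>datasets D n. \<forall>u.
               case num_queries D \<beta> x (noise_of eps1 eps2 u) of
                 Some q \<Rightarrow> \<exists>m y. returns p D \<beta> eps1 eps2 x u m y
                             \<and> var_output D \<beta> x (noise_of eps1 eps2 u) = Some y
                             \<and> m \<le> C * (n + q)
               | None \<Rightarrow> \<not> (\<exists>m y. returns p D \<beta> eps1 eps2 x u m y)))"
proof (intro conjI)
  show "\<forall>D n \<beta> eps1 eps2.
            valid_domain D \<and> n \<ge> 1 \<and> \<beta> > 1 \<and> eps1 > 0 \<and> eps2 > 0 \<longrightarrow>
            differentially_private (datasets D n) output_space (eps1 + 2 * eps2)
              (var_mechanism D \<beta> eps1 eps2)"
    using var_mechanism_private by blast
next
  show "\<exists>p. \<exists>C::nat. \<forall>D n \<beta> eps1 eps2.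
            valid_domain D \<and> n \<ge> 1 \<and> \<beta> > 1 \<and> eps1 > 0 \<and> eps2 > 0 \<longrightarrow>
            (\<forall>x\<in>datasets D n. \<forall>u.
               case num_queries D \<beta> x (noise_of eps1 eps2 u) of
                 Some q \<Rightarrow> \<exists>m y. returns p D \<beta> eps1 eps2 x u m y
                             \<and> var_output D \<beta> x (noise_of eps1 eps2 u) = Some y
                             \<and> m \<le> C * (n + q)
               | None \<Rightarrow> \<not> (\<exists>m y. returns p D \<beta> eps1 eps2 x u m y))"
  proof (rule exI[of _ program], rule exI[of _ 14360400], intro allI impI ballI, elim conjE)
    fix D and n :: nat and \<beta> eps1 eps2 :: real and x u
    assume "valid_domain D" "n \<ge> 1" "\<beta> > 1" "x \<in> datasets D n"
    then show "case num_queries D \<beta> x (noise_of eps1 eps2 u) of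
        Some q \<Rightarrow> \<exists>m y. returns program D \<beta> eps1 eps2 x u m y
                    \<and> var_output D \<beta> x (noise_of eps1 eps2 u) = Some y
                    \<and> m \<le> 14360400 * (n + q)
      | None \<Rightarrow> \<not> (\<exists>m y. returns program D \<beta> eps1 eps2 x u m y)"
      using program_returns[of x D n \<beta> eps1 eps2 u] program_diverges[of x D n \<beta> eps1 eps2 u]
      by (auto simp: var_output_def split: option.split)
  qed
qed

end
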